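(* Let $F$ be a smooth real function on an open subset of $\mathbb{R}^3$, $\Sigma=F^{-1}(c)$ a regular level surface, and $\mathcal{U}_p\subseteq\mathbb{R}^3$ a neighborhood of a point $p\in\Sigma$ with $\det(\mathrm{Hess}_pF)\neq0$, on which $\mathrm{Hess}\,F$ is non-degenerate with constant index. Equip $\mathcal{U}_p$ with the Hessian metric $h$. If $\alpha:I\to\mathcal{U}_p\cap\Sigma$ is a $C^2$ regular curve, which in case $\mathrm{index}(\mathrm{Hess}\,F)\notin\{0,3\}$ has no asymptotic direction, i.e. $\kappa_n(\alpha,\alpha')\neq0$ everywhere, then its normal development $(\kappa_1,\kappa_2)$ with respect to a rotation minimizing frame $\{\mathbf t,\mathbf n_1,\mathbf n_2\}$ of $h$ satisfies $$a_2(s)\kappa_2(s)+a_1(s)\kappa_1(s)+a_0(s)=0,\qquad(\ast)$$ where $a_0=H^F(\mathbf t,\mathbf t)$, $a_i=\epsilon_i\,h(\mathrm{grad}_\alpha F,\mathbf n_i)$, and moreover $a_i'=\epsilon_iH^F(\mathbf t,\mathbf n_i)$, with $\epsilon_i=h(\mathbf n_i,\mathbf n_i)=\pm1$ (so $\epsilon_i=1$ if the index is $0$ or $3$). Conversely, if $\alpha:I\to\mathcal{U}_p$ is a $C^2$ regular curve (with $h(\alpha',\alpha')\ne0$) for which $(\ast)$ holds with $a_0=H^F(\mathbf t,\mathbf t)$, $a_i=\epsilon_ih(\mathrm{grad}_\alpha F,\mathbf n_i)$, and $h(\mathrm{grad}_{\alpha(s_0)}F,\mathbf t(s_0))=0$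 at some point $\alpha(s_0)$, then $\alpha$ lies in a level surface of $F$.
   Context: Hessian (pseudo-)metric: $h(\cdot,\cdot)_q=\langle\mathrm{Hess}_qF\,\cdot,\cdot\rangle$ if $\mathrm{Hess}\,F=(\partial^2F/\partial x^i\partial x^j)$ has index $0$ or $1$, and $h(\cdot,\cdot)_q=-\langle\mathrm{Hess}_qF\,\cdot,\cdot\rangle$ if it has index $2$ or $3$ (so $h$ is Riemannian or of index 1), where $\langle\cdot,\cdot\rangle$ is the standard inner product and the index is the number of negative eigenvalues. $\kappa_n(q,\mathbf v)=\langle\mathrm{Hess}_qF\,\mathbf v,\mathbf v\rangle/\Vert\nabla_qF\Vert$ is the Euclidean normal curvature of the level surface. $D$ is the Levi-Civita connection of $h$ (also the covariant derivative along $\alpha$), $\mathrm{grad}F$ the gradient of $F$ with respect to $h$, and $H^F(X,Y)=h(D_X\mathrm{grad}F,Y)$ the Hessian of $F$ with respect to $h$. The curve is parametrized by $h$-arc-length, $h(\mathbf t,\mathbf t)=\epsilon=\pm1$, $\mathbf t=\alpha'$. A rotation minimizing frame with respect to $h$ is an $h$-orthonormal frame $\{\mathbf t,\mathbf n_1,\mathbf n_2\}$ along $\alpha$ with $D\mathbf n_i/ds$ parallel to $\mathbf t$; with $\kappa_i=h(D\mathbf t/ds,\mathbf n_i)$ one has $D\mathbf t/ds=\epsilon_1\kappa_1\mathbf n_1+\epsilon_2\kappa_2\mathbf n_2$ and $D\mathbf n_i/ds=-\epsilon\kappa_i\mathbf t$. The normal development is $(\kappa_1,\kappa_2)$. *)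

theory Defs
  imports "HOL-Analysis.Analysis"
begin

definition partial :: "'n::finite \<Rightarrow> (real ^ 'n \<Rightarrow> 'b::real_normed_vector) \<Rightarrow> real ^ 'n \<Rightarrow> 'b"
  where "partial i f q = vector_derivative (\<lambda>r. f (q + r *\<^sub>R axis i 1)) (at 0)"

text \<open>Class \<open>C\<^sup>\<infinity>\<close>, for an open set: all iterated partial derivatives exist and are
  differentiable, hence continuous.\<close>

definition smooth_on :: "(real ^ 'n::finite) set \<Rightarrow> (real ^ 'n \<Rightarrow> 'b::real_normed_vector) \<Rightarrow> bool"
  where "smooth_on S f \<longleftrightarrow> (\<forall>is. \<forall>q\<in>S. foldr partial is f differentiable (at q))"

definition egrad :: "(real ^ 'n::finite \<Rightarrow> real) \<Rightarrow> real ^ 'n \<Rightarrow> real ^ 'n"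
  where "egrad F q = (\<chi> i. partial i F q)"

definition Hess :: "(real ^ 'n::finite \<Rightarrow> real) \<Rightarrow> real ^ 'n \<Rightarrow> real ^ 'n ^ 'n"
  where "Hess F q = (\<chi> i j. partial i (partial j F) q)"

definition level_set :: "(real ^ 'n::finite) set \<Rightarrow> (real ^ 'n \<Rightarrow> real) \<Rightarrow> real \<Rightarrow> (real ^ 'n) set"
  where "level_set \<Omega> F c = {q \<in> \<Omega>. F q = c}"

text \<open>Number of negative eigenvalues of a symmetric matrix, counted with multiplicity.\<close>

definition matrix_index :: "real ^ 'n::finite ^ 'n \<Rightarrow> nat"
  where "matrix_index A =
    (\<Sum>\<mu> | \<mu> < 0 \<and> (\<exists>v. v \<noteq> 0 \<and> A *v v = \<mu> *\<^sub>R v). dim {v. A *v v = \<mu> *\<^sub>R v})"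

type_synonym 'n metric = "real ^ 'n \<Rightarrow> real ^ 'n \<Rightarrow> real ^ 'n \<Rightarrow> real"

definition hessian_metric :: "(real ^ 3 \<Rightarrow> real) \<Rightarrow> 3 metric"
  where "hessian_metric F q v w =
    (if matrix_index (Hess F q) \<in> {0, 1} then inner (Hess F q *v v) w
     else - inner (Hess F q *v v) w)"

definition normal_curvature :: "(real ^ 'n::finite \<Rightarrow> real) \<Rightarrow> real ^ 'n \<Rightarrow> real ^ 'n \<Rightarrow> real"
  where "normal_curvature F q v = inner (Hess F q *v v) v / norm (egrad F q)"

text \<open>An affine connection on an open subset of \<open>\<real>\<^sup>n\<close> is given by its Christoffel map
  \<open>\<Gamma> q v w = (\<Sum>i j k. v\<^sub>i w\<^sub>j \<Gamma>\<^sub>i\<^sub>j\<^sup>k e\<^sub>k)\<close>, bilinear in \<open>v\<close> and \<open>w\<close>.\<close>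

type_synonym 'n christoffel = "real ^ 'n \<Rightarrow> real ^ 'n \<Rightarrow> real ^ 'n \<Rightarrow> real ^ 'n"

definition cov_deriv ::
    "'n::finite christoffel \<Rightarrow> (real ^ 'n \<Rightarrow> real ^ 'n) \<Rightarrow> real ^ 'n \<Rightarrow> real ^ 'n \<Rightarrow> real ^ 'n"
  where "cov_deriv \<Gamma> Y q v = frechet_derivative Y (at q) v + \<Gamma> q v (Y q)"

text \<open>The torsion-free metric connection; for nondegenerate symmetric \<open>g\<close> it is unique, and exists by
  \<open>levi_civita_exists\<close> below; smoothness of \<open>\<Gamma>\<close> follows from that of \<open>g\<close>.\<close>

definition levi_civita :: "(real ^ 'n::finite) set \<Rightarrow> 'n metric \<Rightarrow> 'n christoffel \<Rightarrow> bool"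
  where "levi_civita U g \<Gamma> \<longleftrightarrow>
    (\<forall>q\<in>U. bilinear (\<Gamma> q)) \<and>
    (\<forall>X Y. smooth_on U X \<longrightarrow> smooth_on U Y \<longrightarrow> (\<forall>q\<in>U.
      cov_deriv \<Gamma> Y q (X q) - cov_deriv \<Gamma> X q (Y q) =
      frechet_derivative Y (at q) (X q) - frechet_derivative X (at q) (Y q))) \<and>
    (\<forall>X Y Z. smooth_on U X \<longrightarrow> smooth_on U Y \<longrightarrow> smooth_on U Z \<longrightarrow> (\<forall>q\<in>U.
      frechet_derivative (\<lambda>x. g x (Y x) (Z x)) (at q) (X q) =
      g q (cov_deriv \<Gamma> Y q (X q)) (Z q) + g q (Y q) (cov_deriv \<Gamma> Z q (X q))))"

definition metric_grad :: "'n::finite metric \<Rightarrow> (real ^ 'n \<Rightarrow> real) \<Rightarrow> real ^ 'n \<Rightarrow> real ^ 'n"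
  where "metric_grad g F q = (THE w. \<forall>v. g q w v = frechet_derivative F (at q) v)"

definition metric_hess ::
    "'n::finite metric \<Rightarrow> 'n christoffel \<Rightarrow> (real ^ 'n \<Rightarrow> real) \<Rightarrow> 'n metric"
  where "metric_hess g \<Gamma> F q v w = g q (cov_deriv \<Gamma> (metric_grad g F) q v) w"

text \<open>Derivatives are taken within the interval, so they are one-sided at end points.\<close>

definition velocity :: "real set \<Rightarrow> (real \<Rightarrow> 'b::real_normed_vector) \<Rightarrow> real \<Rightarrow> 'b"
  where "velocity I \<alpha> u = vector_derivative \<alpha> (at u within I)"

definition C1_on :: "real set \<Rightarrow> (real \<Rightarrow> 'b::real_normed_vector) \<Rightarrow> bool"
  where "C1_on I \<alpha> \<longleftrightarrow> (\<forall>u\<in>I. \<alpha> differentiable (at u within I)) \<and> continuous_on I (velocity I \<alpha>)"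

definition C2_on :: "real set \<Rightarrow> (real \<Rightarrow> 'b::real_normed_vector) \<Rightarrow> bool"
  where "C2_on I \<alpha> \<longleftrightarrow> C1_on I \<alpha> \<and> C1_on I (velocity I \<alpha>)"

definition regular_C2_curve :: "real set \<Rightarrow> (real \<Rightarrow> 'b::real_normed_vector) \<Rightarrow> bool"
  where "regular_C2_curve I \<alpha> \<longleftrightarrow>
    is_interval I \<and> interior I \<noteq> {} \<and> C2_on I \<alpha> \<and> (\<forall>u\<in>I. velocity I \<alpha> u \<noteq> 0)"

text \<open>\<open>\<alpha> \<circ> \<phi>\<close>, defined on the interval \<open>J\<close>, is a reparametrization of \<open>\<alpha>\<close> by \<open>g\<close>-arc-length,
  of causal character \<open>\<epsilon>\<close>.\<close>

definition arclength_reparam ::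
    "'n::finite metric \<Rightarrow> real set \<Rightarrow> (real \<Rightarrow> real ^ 'n) \<Rightarrow> real set \<Rightarrow> (real \<Rightarrow> real) \<Rightarrow> real \<Rightarrow> bool"
  where "arclength_reparam g I \<alpha> J \<phi> \<epsilon> \<longleftrightarrow>
    is_interval J \<and> bij_betw \<phi> J I \<and> C2_on J \<phi> \<and> (\<forall>s\<in>J. velocity J \<phi> s \<noteq> 0) \<and>
    \<epsilon> \<in> {-1, 1} \<and>
    (\<forall>s\<in>J. g (\<alpha> (\<phi> s)) (velocity J (\<alpha> \<circ> \<phi>) s) (velocity J (\<alpha> \<circ> \<phi>) s) = \<epsilon>)"

definition cov_deriv_along ::
    "'n::finite christoffel \<Rightarrow> real set \<Rightarrow> (real \<Rightarrow> real ^ 'n) \<Rightarrow> (real \<Rightarrow> real ^ 'n) \<Rightarrow> real \<Rightarrow> real ^ 'n"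
  where "cov_deriv_along \<Gamma> J \<beta> V s = velocity J V s + \<Gamma> (\<beta> s) (velocity J \<beta> s) (V s)"

definition rotation_minimizing_frame ::
    "3 metric \<Rightarrow> 3 christoffel \<Rightarrow> real set \<Rightarrow> (real \<Rightarrow> real ^ 3) \<Rightarrow>
     (real \<Rightarrow> real ^ 3) \<Rightarrow> (real \<Rightarrow> real ^ 3) \<Rightarrow> (real \<Rightarrow> real ^ 3) \<Rightarrow> real \<Rightarrow> real \<Rightarrow> real \<Rightarrow> bool"
  where "rotation_minimizing_frame g \<Gamma> J \<beta> t n1 n2 \<epsilon> \<epsilon>1 \<epsilon>2 \<longleftrightarrow>
    \<epsilon> \<in> {-1, 1} \<and> \<epsilon>1 \<in> {-1, 1} \<and> \<epsilon>2 \<in> {-1, 1} \<and>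
    (\<forall>s\<in>J. t s = velocity J \<beta> s \<and>
      g (\<beta> s) (t s) (t s) = \<epsilon> \<and> g (\<beta> s) (n1 s) (n1 s) = \<epsilon>1 \<and> g (\<beta> s) (n2 s) (n2 s) = \<epsilon>2 \<and>
      g (\<beta> s) (t s) (n1 s) = 0 \<and> g (\<beta> s) (t s) (n2 s) = 0 \<and> g (\<beta> s) (n1 s) (n2 s) = 0) \<and>
    (\<forall>n\<in>{n1, n2}. \<forall>s\<in>J. n differentiable (at s within J) \<and>
      (\<exists>b. cov_deriv_along \<Gamma> J \<beta> n s = b *\<^sub>R t s))"

text \<open>The component \<open>\<kappa>\<^sub>i = g (Dt/ds, n\<^sub>i)\<close> of the normal development.\<close>

definition normal_dev ::
    "'n::finite metric \<Rightarrow> 'n christoffel \<Rightarrow> real set \<Rightarrow> (real \<Rightarrow> real ^ 'n) \<Rightarrow>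
     (real \<Rightarrow> real ^ 'n) \<Rightarrow> (real \<Rightarrow> real ^ 'n) \<Rightarrow> real \<Rightarrow> real"
  where "normal_dev g \<Gamma> J \<beta> t n s = g (\<beta> s) (cov_deriv_along \<Gamma> J \<beta> t s) (n s)"

lemma smooth_on_imp_differentiable: "smooth_on S f \<Longrightarrow> q \<in> S \<Longrightarrow> f differentiable (at q)"
  unfolding smooth_on_def by (drule spec[of _ "[]"]) simp

lemma riesz_nondegenerate:
  fixes b :: "real ^ 'n::finite \<Rightarrow> real ^ 'n \<Rightarrow> real"
  assumes b: "bilinear b" and nd: "\<And>w. (\<And>z. b w z = 0) \<Longrightarrow> w = 0" and f: "linear f"
  shows "\<exists>w. \<forall>z. b w z = f z"
proof -
  let ?T = "\<lambda>w. (\<chi> i. b w (axis i 1)) :: real ^ 'n"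
  have bl: "linear (b w)" "linear (\<lambda>w. b w z)" for w z
    using b unfolding bilinear_def by auto
  have ax: "l z = (\<Sum>i\<in>UNIV. z $ i * l (axis i 1))" if "linear l" for l :: "real ^ 'n \<Rightarrow> real" and z
  proof -
    have "l z = l (\<Sum>i\<in>UNIV. z $ i *\<^sub>R axis i 1)"
      by (metis (no_types, lifting) basis_expansion scalar_mult_eq_scaleR sum.cong)
    also have "\<dots> = (\<Sum>i\<in>UNIV. z $ i * l (axis i 1))"
      using that by (simp add: linear_sum linear_cmul)
    finally show ?thesis .
  qed
  have T: "linear ?T"
    by (rule linearI)
      (auto simp: vec_eq_iff linear_add[OF bl(2)] linear_cmul[OF bl(2)])
  have "inj ?T"
  proof (subst linear_injective_0[OF T], intro allI impI)
    fix w assume "?T w = 0"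
    hence "b w (axis i 1) = 0" for i by (simp add: vec_eq_iff)
    hence "b w z = 0" for z using ax[OF bl(1)[of w], of z] by simp
    thus "w = 0" by (rule nd)
  qed
  hence "surj ?T" by (rule linear_injective_imp_surjective[OF T _ refl])
  then obtain w where w: "?T w = (\<chi> i. f (axis i 1))" unfolding surj_def by (rule allE) (erule exE, drule sym, rule that)
  have "b w (axis i 1) = f (axis i 1)" for i using w by (simp add: vec_eq_iff)
  hence "b w z = f z" for z
    using ax[OF bl(1)[of w], of z] ax[OF f, of z] by simp
  thus ?thesis by blast
qed

lemma levi_civita_exists:
  fixes g :: "'n::finite metric"
  assumes bil: "\<And>q. q \<in> U \<Longrightarrow> bilinear (g q)"
    and sym: "\<And>q v w. q \<in> U \<Longrightarrow> g q v w = g q w v"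
    and nd: "\<And>q w. q \<in> U \<Longrightarrow> (\<And>z. g q w z = 0) \<Longrightarrow> w = 0"
    and diff: "\<And>q v w. q \<in> U \<Longrightarrow> (\<lambda>x. g x v w) differentiable (at q)"
    and U: "open U"
  shows "\<exists>\<Gamma>. levi_civita U g \<Gamma>"
proof -
  define gd where "gd q v w = frechet_derivative (\<lambda>x. g x v w) (at q)" for q v w
  have gd: "((\<lambda>x. g x v w) has_derivative gd q v w) (at q)" if "q \<in> U" for q v w
    using diff[OF that] frechet_derivative_works unfolding gd_def by blast
  note bl = bilinear_ladd[OF bil] bilinear_radd[OF bil] bilinear_lmul[OF bil] bilinear_rmul[OF bil]
  have lin: "linear (gd q v w)" if "q \<in> U" for q v w
    using gd[OF that] has_derivative_linear by blast
  have ev: "eventually (\<lambda>x. x \<in> U) (at q)" if "q \<in> U" for q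
    using U that eventually_at_topological by blast
  have cong: "gd q v w = D" if q: "q \<in> U" and D: "(f has_derivative D) (at q)"
    and eq: "\<And>x. x \<in> U \<Longrightarrow> f x = g x v w" for q v w f D
  proof -
    have "((\<lambda>x. g x v w) has_derivative D) (at q)"
      using has_derivative_transform_within_open[OF D U q eq] .
    thus ?thesis using gd[OF q] has_derivative_unique by blast
  qed
  have gd_sym: "gd q v w = gd q w v" if "q \<in> U" for q v w
    by (rule cong[OF that gd[OF that]]) (simp add: sym)
  have gd_addl: "gd q (v + v') w z = gd q v w z + gd q v' w z" if q: "q \<in> U" for q v v' w z
    by (subst cong[OF q has_derivative_add[OF gd[OF q] gd[OF q]]]) (auto simp: bl)
  have gd_mull: "gd q (r *\<^sub>R v) w z = r * gd q v w z" if q: "q \<in> U" for q v w z r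
    by (subst cong[OF q has_derivative_mult_right[OF gd[OF q]]]) (auto simp: bl)
  have gd_addr: "gd q w (v + v') z = gd q w v z + gd q w v' z" if q: "q \<in> U" for q v v' w z
    by (simp add: gd_sym[OF q, of w] gd_addl[OF q])
  have gd_mulr: "gd q w (r *\<^sub>R v) z = r * gd q w v z" if q: "q \<in> U" for q v w z r
    by (simp add: gd_sym[OF q, of w] gd_mull[OF q])
  note gds = gd_addl gd_addr gd_mull gd_mulr
  define K where "K q u v z = (gd q v z u + gd q u z v - gd q u v z) / 2" for q u v z
  define \<Gamma> where "\<Gamma> q u v = (SOME w. \<forall>z. g q w z = K q u v z)" for q u v
  have \<Gamma>: "g q (\<Gamma> q u v) z = K q u v z" if q: "q \<in> U" for q u v z
  proof -
    have "linear (K q u v)"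
      by (rule linearI)
        (auto simp: K_def gds q linear_add[OF lin[OF q]] linear_cmul[OF lin[OF q]] field_simps)
    from riesz_nondegenerate[OF bil[OF q] nd[OF q] this]
    have "\<exists>w. \<forall>z. g q w z = K q u v z" by blast
    from someI_ex[OF this] show ?thesis unfolding \<Gamma>_def by blast
  qed
  have eqI: "w = w'" if q: "q \<in> U" and "\<And>z. g q w z = g q w' z" for q w w'
  proof -
    have "g q (w - w') z = 0" for z
      using that(2)[of z] bilinear_lsub[OF bil[OF q]] by simp
    hence "w - w' = 0" by (rule nd[OF q])
    thus ?thesis by simp
  qed
  have \<Gamma>_sym: "\<Gamma> q u v = \<Gamma> q v u" if q: "q \<in> U" for q u v
    by (rule eqI[OF q]) (simp add: \<Gamma> q K_def gd_sym[OF q, of u v])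
  have \<Gamma>_bil: "bilinear (\<Gamma> q)" if q: "q \<in> U" for q
  proof -
    have *: "linear (\<Gamma> q u)" for u
      by (rule linearI; rule eqI[OF q])
        (auto simp: \<Gamma> q bl gds K_def linear_add[OF lin[OF q]] linear_cmul[OF lin[OF q]] field_simps)
    have "(\<lambda>u. \<Gamma> q u v) = \<Gamma> q v" for v using \<Gamma>_sym[OF q] by blast
    thus ?thesis using * unfolding bilinear_def by simp
  qed
  have \<Gamma>_met: "gd q v w u = g q (\<Gamma> q u v) w + g q v (\<Gamma> q u w)" if q: "q \<in> U" for q u v w
    using sym[OF q, of v "\<Gamma> q u w"]
    by (simp add: \<Gamma> q K_def gd_sym[OF q, of w v] field_simps)
  have leibniz: "frechet_derivative (\<lambda>x. g x (Y x) (Z x)) (at q) u =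
      gd q (Y q) (Z q) u + g q (frechet_derivative Y (at q) u) (Z q)
      + g q (Y q) (frechet_derivative Z (at q) u)"
    if q: "q \<in> U" and Y: "Y differentiable (at q)" and Z: "Z differentiable (at q)" for q Y Z u
  proof -
    let ?e = "\<lambda>i. axis i 1 :: real ^ 'n"
    have expand: "g x v w = (\<Sum>i\<in>UNIV. \<Sum>j\<in>UNIV. v $ i * w $ j * g x (?e i) (?e j))"
      if x: "x \<in> U" for x v w
    proof -
      have "g x v w = g x (\<Sum>i\<in>UNIV. v $ i *\<^sub>R ?e i) (\<Sum>j\<in>UNIV. w $ j *\<^sub>R ?e j)"
        by (metis (no_types, lifting) basis_expansion scalar_mult_eq_scaleR sum.cong)
      also have "\<dots> = (\<Sum>(i, j)\<in>UNIV \<times> UNIV. g x (v $ i *\<^sub>R ?e i) (w $ j *\<^sub>R ?e j))"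
        by (rule bilinear_sum[OF bil[OF x]])
      also have "\<dots> = (\<Sum>(i, j)\<in>UNIV \<times> UNIV. v $ i * w $ j * g x (?e i) (?e j))"
        by (rule sum.cong) (auto simp: bl x)
      finally show ?thesis by (simp add: sum.cartesian_product)
    qed
    define Y' where "Y' = frechet_derivative Y (at q)"
    define Z' where "Z' = frechet_derivative Z (at q)"
    have Y': "((\<lambda>x. Y x $ i) has_derivative (\<lambda>u. Y' u $ i)) (at q)" for i
      using Y frechet_derivative_works unfolding Y'_def
      by (blast intro: bounded_linear.has_derivative[OF bounded_linear_vec_nth])
    have Z': "((\<lambda>x. Z x $ i) has_derivative (\<lambda>u. Z' u $ i)) (at q)" for i
      using Z frechet_derivative_works unfolding Z'_def
      by (blast intro: bounded_linear.has_derivative[OF bounded_linear_vec_nth])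
    have gd_expand: "gd q v w u = (\<Sum>i\<in>UNIV. \<Sum>j\<in>UNIV. v $ i * w $ j * gd q (?e i) (?e j) u)" for v w
    proof -
      have "((\<lambda>x. \<Sum>i\<in>UNIV. \<Sum>j\<in>UNIV. v $ i * w $ j * g x (?e i) (?e j)) has_derivative
        (\<lambda>u. \<Sum>i\<in>UNIV. \<Sum>j\<in>UNIV. v $ i * w $ j * gd q (?e i) (?e j) u)) (at q)"
        by (intro has_derivative_sum has_derivative_mult_right gd[OF q])
      from cong[OF q this expand[symmetric]] show ?thesis by simp
    qed
    have "((\<lambda>x. \<Sum>i\<in>UNIV. \<Sum>j\<in>UNIV. Y x $ i * Z x $ j * g x (?e i) (?e j)) has_derivative
      (\<lambda>u. \<Sum>i\<in>UNIV. \<Sum>j\<in>UNIV. (Y q $ i * Z q $ j) * gd q (?e i) (?e j) u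
         + (Y q $ i * Z' u $ j + Y' u $ i * Z q $ j) * g q (?e i) (?e j))) (at q)"
      by (intro has_derivative_sum has_derivative_mult gd[OF q] Y' Z')
    hence "((\<lambda>x. g x (Y x) (Z x)) has_derivative
      (\<lambda>u. \<Sum>i\<in>UNIV. \<Sum>j\<in>UNIV. (Y q $ i * Z q $ j) * gd q (?e i) (?e j) u
         + (Y q $ i * Z' u $ j + Y' u $ i * Z q $ j) * g q (?e i) (?e j))) (at q)"
      by (rule has_derivative_transform_within_open[OF _ U q]) (rule expand[symmetric])
    from frechet_derivative_at[OF this, symmetric]
    have "frechet_derivative (\<lambda>x. g x (Y x) (Z x)) (at q) u =
      (\<Sum>i\<in>UNIV. \<Sum>j\<in>UNIV. (Y q $ i * Z q $ j) * gd q (?e i) (?e j) u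
         + (Y q $ i * Z' u $ j + Y' u $ i * Z q $ j) * g q (?e i) (?e j))"
      by simp
    also have "\<dots> = gd q (Y q) (Z q) u + g q (Y' u) (Z q) + g q (Y q) (Z' u)"
      unfolding gd_expand[of "Y q" "Z q"] expand[OF q, of "Y' u" "Z q"] expand[OF q, of "Y q" "Z' u"]
      by (simp add: sum.distrib distrib_left distrib_right)
    finally show ?thesis unfolding Y'_def Z'_def .
  qed
  have "levi_civita U g \<Gamma>"
    unfolding levi_civita_def cov_deriv_def
  proof (intro conjI allI impI ballI)
    fix q and X Y :: "real ^ 'n \<Rightarrow> real ^ 'n" assume q: "q \<in> U"
    show "frechet_derivative Y (at q) (X q) + \<Gamma> q (X q) (Y q)
        - (frechet_derivative X (at q) (Y q) + \<Gamma> q (Y q) (X q))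
        = frechet_derivative Y (at q) (X q) - frechet_derivative X (at q) (Y q)"
      using \<Gamma>_sym[OF q, of "X q" "Y q"] by simp
  next
    fix q and X Y Z :: "real ^ 'n \<Rightarrow> real ^ 'n" assume q: "q \<in> U" and "smooth_on U Y" "smooth_on U Z"
    then have "Y differentiable (at q)" "Z differentiable (at q)"
      using smooth_on_imp_differentiable by blast+
    from leibniz[OF q this, of "X q"]
    show "frechet_derivative (\<lambda>x. g x (Y x) (Z x)) (at q) (X q)
        = g q (frechet_derivative Y (at q) (X q) + \<Gamma> q (X q) (Y q)) (Z q)
        + g q (Y q) (frechet_derivative Z (at q) (X q) + \<Gamma> q (X q) (Z q))"
      using \<Gamma>_met[OF q, of "Y q" "Z q" "X q"] by (simp add: bl(1,2)[OF q])
  qed (rule \<Gamma>_bil)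
  thus ?thesis by blast
qed

end

theory Submission
  imports Defs
begin

text \<open>Let \<open>\<beta>\<close> be the curve in arc-length parametrization and \<open>f = h(grad F, t)\<close>, which is the
  derivative of \<open>F \<circ> \<beta>\<close>.  Compatibility of the connection with the metric gives
  \<open>f' = H\<^sup>F(t, t) + h(grad F, Dt)\<close>.  As \<open>h(t, t)\<close> is constant, \<open>Dt\<close> is orthogonal to \<open>t\<close>, and expanding
  it in the frame turns this into \<open>f' = a\<^sub>0 + a\<^sub>1 \<kappa>\<^sub>1 + a\<^sub>2 \<kappa>\<^sub>2\<close>.  If the curve lies in a level surface,
  then \<open>f\<close> vanishes identically and so does \<open>f'\<close>; this is the asserted linear relation.  If the
  relation holds, then \<open>f\<close> is constant, hence zero because it vanishes at one point, and therefore
  \<open>F \<circ> \<beta>\<close> is constant.  The formula for \<open>a\<^sub>i'\<close> is the same computation with \<open>n\<^sub>i\<close> in place of \<open>t\<close>: the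
  second term disappears because \<open>Dn\<^sub>i\<close> is a multiple of \<open>t\<close>.  These computations are
  \<open>has_real_derivative_grad_pairing\<close> and \<open>rotation_minimizing_frame_derivatives\<close>.

  They presuppose that the Hessian metric is a nondegenerate symmetric metric of class \<open>C\<^sup>1\<close>
  (\<open>metric_connection_Hessian\<close>, which rests on the symmetry of second partial derivatives,
  \<open>mixed_partials_commute\<close>) and that \<open>grad F\<close> is differentiable (\<open>differentiable_metric_grad\<close>, by
  Cramer's rule).

  A reparametrization by arc length exists because \<open>h(\<alpha>', \<alpha>')\<close> is continuous without zeros
  (\<open>arclength_reparam_exists\<close>): for index 1 or 2 this is the absence of asymptotic directions, and for
  index 0 or 3 it holds because \<open>h\<close> is positive definite.  The latter also yields
  \<open>\<epsilon>\<^sub>1 = \<epsilon>\<^sub>2 = 1\<close>.  Definiteness is read off from the index, a sum of dimensions of eigenspaces, by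
  means of the eigenvector at which the quadratic form is extremal on the unit sphere
  (\<open>rayleigh_minimum\<close>).\<close>

section \<open>Partial derivatives and the symmetry of the Hessian\<close>

lemma vec_expand_axis: "v = (\<Sum>i\<in>UNIV. v $ i *\<^sub>R axis i (1::real))"
  by (metis (no_types, lifting) basis_expansion scalar_mult_eq_scaleR sum.cong)

lemma linear_expand_axis:
  fixes f :: "real ^ 'n::finite \<Rightarrow> 'b::real_vector"
  assumes "linear f"
  shows "f v = (\<Sum>i\<in>UNIV. v $ i *\<^sub>R f (axis i 1))"
  by (subst vec_expand_axis[of v]) (simp add: linear_sum[OF assms] linear_cmul[OF assms])

lemma bilinear_expand_axis:
  fixes b :: "real ^ 'n::finite \<Rightarrow> real ^ 'm::finite \<Rightarrow> real"
  assumes "bilinear b"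
  shows "b v w = (\<Sum>i\<in>UNIV. \<Sum>j\<in>UNIV. v $ i * w $ j * b (axis i 1) (axis j 1))"
proof -
  have l: "linear (b x)" "linear (\<lambda>x. b x y)" for x y
    using assms by (auto simp: bilinear_def)
  show ?thesis
    by (subst linear_expand_axis[OF l(2)], subst linear_expand_axis[OF l(1)])
      (simp add: sum_distrib_left mult.assoc)
qed

lemma partial_eq_frechet_derivative:
  assumes "f differentiable (at q)"
  shows "partial i f q = frechet_derivative f (at q) (axis i 1)"
proof -
  let ?D = "frechet_derivative f (at q)"
  have D: "(f has_derivative ?D) (at (q + 0 *\<^sub>R axis i 1))"
    using assms by (simp add: frechet_derivative_works)
  have "((\<lambda>r. q + r *\<^sub>R axis i 1) has_derivative (\<lambda>r. r *\<^sub>R axis i 1)) (at (0::real))"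
    by (auto intro!: derivative_eq_intros)
  from diff_chain_at[OF this] D
  have "((\<lambda>r. f (q + r *\<^sub>R axis i 1)) has_derivative (\<lambda>r. ?D (r *\<^sub>R axis i 1))) (at 0)"
    by (auto simp: o_def)
  moreover have "?D (r *\<^sub>R axis i 1) = r *\<^sub>R ?D (axis i 1)" for r
    using linear_cmul[OF linear_frechet_derivative[OF assms]] .
  ultimately show ?thesis
    by (simp add: partial_def vector_derivative_at has_vector_derivative_def)
qed

text \<open>The partial derivative at every point of a coordinate line is the derivative of the restriction to
  that line; in this form the one-variable mean value theorem applies.\<close>

lemma has_derivative_along_axis:
  fixes f :: "real ^ 'n::finite \<Rightarrow> real"
  assumes "f differentiable (at (q + x *\<^sub>R axis i 1))"
  shows "((\<lambda>x. f (q + x *\<^sub>R axis i 1)) has_real_derivative partial i f (q + x *\<^sub>R axis i 1)) (at x)"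
proof -
  let ?D = "frechet_derivative f (at (q + x *\<^sub>R axis i 1))"
  have D: "(f has_derivative ?D) (at (q + x *\<^sub>R axis i 1))"
    using assms by (simp add: frechet_derivative_works)
  have "((\<lambda>r. q + r *\<^sub>R axis i 1) has_derivative (\<lambda>r. r *\<^sub>R axis i 1)) (at x)"
    by (auto intro!: derivative_eq_intros)
  from diff_chain_at[OF this D]
  have "((\<lambda>r. f (q + r *\<^sub>R axis i 1)) has_derivative (\<lambda>r. ?D (r *\<^sub>R axis i 1))) (at x)"
    by (auto simp: o_def)
  moreover have "?D (r *\<^sub>R axis i 1) = partial i f (q + x *\<^sub>R axis i 1) * r" for r
    using linear_cmul[OF linear_frechet_derivative[OF assms], of r]
    by (simp add: partial_eq_frechet_derivative[OF assms])
  ultimately show ?thesis by (simp add: has_field_derivative_def)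
qed

text \<open>One half of the theorem on mixed partials.  The second difference over the square with sides
  \<open>t\<close> in the directions \<open>i\<close> and \<open>j\<close> is \<open>\<phi> t - \<phi> 0\<close>, where \<open>\<phi>\<close> is the increment of \<open>f\<close> in
  direction \<open>j\<close> as a function of the coordinate \<open>i\<close>.  The mean value theorem turns it into \<open>t\<close> times a
  first difference of \<open>\<partial>\<^sub>i f\<close>, and differentiability of \<open>\<partial>\<^sub>i f\<close> at the corner \<open>q\<close> evaluates this up to
  \<open>O(e t)\<close>.  Only the limit differs between the two orders of differentiation, because the second
  difference itself is symmetric in \<open>i\<close> and \<open>j\<close>.\<close>

lemma second_difference_estimate:
  fixes f :: "real ^ 'n::finite \<Rightarrow> real"
  assumes S: "open S" "q \<in> S" and f: "\<And>x. x \<in> S \<Longrightarrow> f differentiable (at x)"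
    and fi: "partial i f differentiable (at q)" and e: "e > 0"
  obtains d where "d > 0"
    "\<And>t. 0 < t \<Longrightarrow> t < d \<Longrightarrow>
       \<bar>f (q + t *\<^sub>R axis i 1 + t *\<^sub>R axis j 1) - f (q + t *\<^sub>R axis i 1) - f (q + t *\<^sub>R axis j 1) + f q
         - t\<^sup>2 * partial j (partial i f) q\<bar> \<le> 3 * e * t\<^sup>2"
proof -
  let ?G = "partial i f" and ?D = "frechet_derivative (partial i f) (at q)"
  let ?a = "axis i 1 :: real ^ 'n" and ?b = "axis j 1 :: real ^ 'n"
  have D: "(?G has_derivative ?D) (at q)" using fi frechet_derivative_works by blast
  have lin: "linear ?D" using linear_frechet_derivative[OF fi] .
  obtain r where r: "r > 0" "ball q r \<subseteq> S" using S open_contains_ball by blast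
  obtain d' where d': "d' > 0"
    "\<And>y. norm (y - q) < d' \<Longrightarrow> norm (?G y - ?G q - ?D (y - q)) \<le> e * norm (y - q)"
    using D e unfolding has_derivative_at_alt by blast
  define d where "d = min r d' / 2"
  have small: "norm (x *\<^sub>R ?a + y *\<^sub>R ?b) < min r d'" if "0 \<le> x" "x < d" "0 \<le> y" "y < d" for x y
  proof -
    have "norm (x *\<^sub>R ?a + y *\<^sub>R ?b) \<le> norm (x *\<^sub>R ?a) + norm (y *\<^sub>R ?b)" by (rule norm_triangle_ineq)
    also have "\<dots> = x + y" using that by (simp add: norm_axis_1)
    finally show ?thesis using that unfolding d_def by linarith
  qed
  have inS: "q + x *\<^sub>R ?a + y *\<^sub>R ?b \<in> S" if "0 \<le> x" "x < d" "0 \<le> y" "y < d" for x y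
  proof -
    have "dist q (q + (x *\<^sub>R ?a + y *\<^sub>R ?b)) < r"
      using small[OF that] norm_minus_cancel[of "x *\<^sub>R ?a + y *\<^sub>R ?b"] by (simp add: dist_norm)
    then show ?thesis using r(2) by (auto simp: add.assoc)
  qed
  show ?thesis
  proof
    show "d > 0" using r d' by (simp add: d_def)
    fix t assume t: "0 < t" "t < d"
    let ?\<phi> = "\<lambda>x. f ((q + t *\<^sub>R ?b) + x *\<^sub>R ?a) - f (q + x *\<^sub>R ?a)"
    have "\<exists>\<xi>>0. \<xi> < t \<and> ?\<phi> t - ?\<phi> 0 = (t - 0) * (?G ((q + t *\<^sub>R ?b) + \<xi> *\<^sub>R ?a) - ?G (q + \<xi> *\<^sub>R ?a))"
    proof (rule MVT2[OF t(1)])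
      fix x assume x: "0 \<le> x" "x \<le> t"
      have "(q + t *\<^sub>R ?b) + x *\<^sub>R ?a \<in> S" "q + x *\<^sub>R ?a \<in> S"
        using inS[of x t] inS[of x 0] x t by (auto simp: add.assoc add.commute[of "t *\<^sub>R ?b"])
      then show "(?\<phi> has_real_derivative (?G ((q + t *\<^sub>R ?b) + x *\<^sub>R ?a) - ?G (q + x *\<^sub>R ?a))) (at x)"
        by (intro DERIV_diff has_derivative_along_axis f)
    qed
    then obtain \<xi> where \<xi>: "0 < \<xi>" "\<xi> < t"
      "?\<phi> t - ?\<phi> 0 = t * (?G ((q + t *\<^sub>R ?b) + \<xi> *\<^sub>R ?a) - ?G (q + \<xi> *\<^sub>R ?a))" by auto
    have n2: "norm (\<xi> *\<^sub>R ?a) = \<xi>" using \<xi> by (simp add: norm_axis_1)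
    have n1: "norm (\<xi> *\<^sub>R ?a + t *\<^sub>R ?b) \<le> \<xi> + t"
      using norm_triangle_ineq[of "\<xi> *\<^sub>R ?a" "t *\<^sub>R ?b"] \<xi> t by (simp add: norm_axis_1)
    define y where "y = \<xi> *\<^sub>R ?a + t *\<^sub>R ?b"
    define z where "z = \<xi> *\<^sub>R ?a"
    have y: "\<bar>?G (q + y) - ?G q - ?D y\<bar> \<le> e * norm y"
      using d'(2)[of "q + y"] small[of \<xi> t] \<xi> t by (simp add: y_def)
    have z: "\<bar>?G (q + z) - ?G q - ?D z\<bar> \<le> e * norm z"
      using d'(2)[of "q + z"] small[of \<xi> 0] \<xi> t by (simp add: z_def)
    \<comment> \<open>The two error terms have lengths at most \<open>2 t\<close> and \<open>t\<close>; this is the origin of the constant 3.\<close>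
    have "e * norm y + e * norm z \<le> e * (3 * t)"
      using n1 n2 \<xi> t e unfolding y_def z_def by (simp flip: distrib_left)
    with y z have "\<bar>(?G (q + y) - ?G (q + z)) - (?D y - ?D z)\<bar> \<le> 3 * e * t" by linarith
    moreover have "?D y - ?D z = t * partial j ?G q"
      by (simp add: y_def z_def linear_add[OF lin] linear_cmul[OF lin] partial_eq_frechet_derivative[OF fi])
    ultimately have "\<bar>(?G (q + y) - ?G (q + z)) - t * partial j ?G q\<bar> \<le> 3 * e * t" by simp
    then have "t * \<bar>(?G (q + y) - ?G (q + z)) - t * partial j ?G q\<bar> \<le> t * (3 * e * t)"
      using t by (intro mult_left_mono) auto
    then have "\<bar>t * ((?G (q + y) - ?G (q + z)) - t * partial j ?G q)\<bar> \<le> t * (3 * e * t)"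
      using t(1) by (subst abs_mult) simp
    moreover have "f (q + t *\<^sub>R ?a + t *\<^sub>R ?b) - f (q + t *\<^sub>R ?a) - f (q + t *\<^sub>R ?b) + f q
         = t * (?G (q + y) - ?G (q + z))"
      using \<xi>(3) by (simp add: y_def z_def add_ac algebra_simps)
    ultimately show "\<bar>f (q + t *\<^sub>R ?a + t *\<^sub>R ?b) - f (q + t *\<^sub>R ?a) - f (q + t *\<^sub>R ?b) + f q
         - t\<^sup>2 * partial j ?G q\<bar> \<le> 3 * e * t\<^sup>2"
      by (simp add: power2_eq_square algebra_simps)
  qed
qed

text \<open>Both mixed partials are limits of the same symmetric second difference divided by \<open>t\<^sup>2\<close>.  If they
  differed by \<open>7 e\<close>, the two estimates with error \<open>3 e t\<^sup>2\<close> would contradict each other.\<close>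

lemma mixed_partials_commute:
  fixes f :: "real ^ 'n::finite \<Rightarrow> real"
  assumes S: "open S" "q \<in> S" and f: "\<And>x. x \<in> S \<Longrightarrow> f differentiable (at x)"
    and fi: "partial i f differentiable (at q)" and fj: "partial j f differentiable (at q)"
  shows "partial i (partial j f) q = partial j (partial i f) q"
proof (rule ccontr)
  assume ne: "\<not> ?thesis"
  define e where "e = \<bar>partial i (partial j f) q - partial j (partial i f) q\<bar> / 7"
  have e: "e > 0" using ne by (simp add: e_def)
  obtain d1 where d1: "d1 > 0"
    "\<And>t. 0 < t \<Longrightarrow> t < d1 \<Longrightarrow>
       \<bar>f (q + t *\<^sub>R axis i 1 + t *\<^sub>R axis j 1) - f (q + t *\<^sub>R axis i 1) - f (q + t *\<^sub>R axis j 1) + f q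
         - t\<^sup>2 * partial j (partial i f) q\<bar> \<le> 3 * e * t\<^sup>2"
    using second_difference_estimate[OF S f fi e, where j = j] by metis
  obtain d2 where d2: "d2 > 0"
    "\<And>t. 0 < t \<Longrightarrow> t < d2 \<Longrightarrow>
       \<bar>f (q + t *\<^sub>R axis j 1 + t *\<^sub>R axis i 1) - f (q + t *\<^sub>R axis j 1) - f (q + t *\<^sub>R axis i 1) + f q
         - t\<^sup>2 * partial i (partial j f) q\<bar> \<le> 3 * e * t\<^sup>2"
    using second_difference_estimate[OF S f fj e, where j = i] by metis
  define t where "t = min d1 d2 / 2"
  have t: "0 < t" "t < d1" "t < d2" using d1(1) d2(1) by (auto simp: t_def)
  have comm: "q + t *\<^sub>R axis j 1 + t *\<^sub>R axis i 1 = q + t *\<^sub>R axis i 1 + t *\<^sub>R axis j 1"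
    by (simp add: add_ac)
  have "\<bar>t\<^sup>2 * partial i (partial j f) q - t\<^sup>2 * partial j (partial i f) q\<bar> \<le> 6 * e * t\<^sup>2"
    using d1(2)[OF t(1,2)] d2(2)[OF t(1,3), unfolded comm] by linarith
  then have "t\<^sup>2 * (7 * e) \<le> t\<^sup>2 * (6 * e)"
    by (simp add: e_def abs_mult flip: right_diff_distrib)
  then have "7 * e \<le> 6 * e" using t(1) by (subst (asm) mult_le_cancel_left_pos) auto
  then show False using e by simp
qed

lemma smooth_on_partial: "smooth_on S f \<Longrightarrow> smooth_on S (partial i f)"
  unfolding smooth_on_def
proof (intro allI ballI)
  fix "is" q assume "\<forall>is. \<forall>q\<in>S. foldr partial is f differentiable at q" "q \<in> S"
  then have "foldr partial (is @ [i]) f differentiable at q" by blast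
  then show "foldr partial is (partial i f) differentiable at q" by simp
qed

lemma smooth_on_const:
  fixes S :: "(real ^ 'n::finite) set" and c :: "'b::real_normed_vector"
  shows "smooth_on S (\<lambda>x. c)"
proof -
  have p: "partial i (\<lambda>x. c) = (\<lambda>x::real ^ 'n. 0)" for i and c :: 'b
    by (simp add: partial_def fun_eq_iff)
  have "\<exists>c'. foldr partial is (\<lambda>x. c) = (\<lambda>x::real ^ 'n. c')" for "is"
    by (induction "is") (auto simp: p)
  then have "foldr partial is (\<lambda>x. c) differentiable (at q)" for "is" and q :: "real ^ 'n"
    using differentiable_const by metis
  then show ?thesis by (simp add: smooth_on_def)
qed

lemma smooth_on_continuous_frechet_derivative:
  fixes f :: "real ^ 'n::finite \<Rightarrow> 'b::real_normed_vector"
  assumes "smooth_on S f"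
  shows "continuous_on S (\<lambda>q. frechet_derivative f (at q) u)"
proof -
  have f: "f differentiable (at q)" if "q \<in> S" for q
    using smooth_on_imp_differentiable[OF assms that] .
  have "continuous_on S (partial i f)" for i
    using smooth_on_imp_differentiable[OF smooth_on_partial[OF assms]]
    by (meson continuous_at_imp_continuous_on differentiable_imp_continuous_within)
  then have "continuous_on S (\<lambda>q. \<Sum>i\<in>UNIV. u $ i *\<^sub>R partial i f q)"
    by (intro continuous_intros)
  then show ?thesis
    by (rule continuous_on_eq)
      (simp add: f partial_eq_frechet_derivative linear_expand_axis[OF linear_frechet_derivative, of f, symmetric])
qed

lemma Hess_symmetric:
  assumes "open S" "smooth_on S F" "q \<in> S"
  shows "transpose (Hess F q) = Hess F q"
proof -
  have "partial j (partial i F) q = partial i (partial j F) q" for i j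
    using assms(3) smooth_on_imp_differentiable[OF assms(2)]
      smooth_on_imp_differentiable[OF smooth_on_partial[OF assms(2)]]
    by (intro mixed_partials_commute[OF assms(1,3)])
  then show ?thesis by (simp add: Hess_def transpose_def vec_eq_iff)
qed

lemma differentiable_vec_nth:
  fixes f :: "'a::real_normed_vector \<Rightarrow> real ^ 'n::finite"
  assumes "\<And>i. (\<lambda>x. f x $ i) differentiable (at a within S)"
  shows "f differentiable (at a within S)"
  using assms by (subst differentiable_componentwise_within) (auto simp: Basis_vec_def inner_axis)

lemma differentiable_prod_finite:
  fixes f :: "'i \<Rightarrow> 'a::real_normed_vector \<Rightarrow> real"
  assumes "finite I" "\<And>i. i \<in> I \<Longrightarrow> f i differentiable (at a within S)"
  shows "(\<lambda>x. \<Prod>i\<in>I. f i x) differentiable (at a within S)"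
  using assms by (induction I rule: finite_induct) (auto intro!: differentiable_mult)


section \<open>The index and definiteness of a symmetric matrix\<close>

text \<open>The index is a sum of dimensions of eigenspaces.  It is related to the sign of the quadratic form by
  the variational characterization of the smallest eigenvalue.\<close>

lemma inner_matrix_commute:
  fixes A :: "real ^ 'n::finite ^ 'n"
  assumes "transpose A = A"
  shows "inner (A *v v) w = inner v (A *v w)"
  using dot_lmul_matrix[of v A w] assms transpose_matrix_vector[of A v] by metis

lemma det_nonzero_imp_kernel_0:
  fixes A :: "real ^ 'n::finite ^ 'n"
  assumes "det A \<noteq> 0" "A *v v = 0"
  shows "v = 0"
proof -
  have "\<exists>B. B ** A = mat 1"
    using assms(1) by (simp add: invertible_det_nz[symmetric] invertible_left_inverse)
  then show ?thesis using assms(2) by (simp add: matrix_left_invertible_ker)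
qed

text \<open>The quadratic form attains its minimum \<open>\<mu>\<close> on the unit sphere, at \<open>v\<close> say.  The form
  \<open>b w z = \<langle>A w, z\<rangle> - \<mu> \<langle>w, z\<rangle>\<close> is then positive semidefinite with \<open>b v v = 0\<close>, and such a null vector
  lies in the radical of the form, which says that \<open>v\<close> is an eigenvector for \<open>\<mu>\<close>.\<close>

lemma rayleigh_minimum:
  fixes A :: "real ^ 'n::finite ^ 'n"
  assumes A: "transpose A = A"
  obtains \<mu> v where "v \<noteq> 0" "A *v v = \<mu> *\<^sub>R v" "\<And>w. \<mu> * inner w w \<le> inner (A *v w) w"
proof -
  let ?q = "\<lambda>w. inner (A *v w) w"
  have "continuous_on (sphere 0 1) ?q"
    by (intro continuous_intros linear_continuous_on bounded_linear.linear
        matrix_vector_mul_bounded_linear)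
  moreover have "sphere (0 :: real ^ 'n) 1 \<noteq> {}" by simp
  ultimately obtain v where v: "norm v = 1" and min: "\<And>w. norm w = 1 \<Longrightarrow> ?q v \<le> ?q w"
    using continuous_attains_inf[of "sphere (0 :: real ^ 'n) 1" ?q] by auto
  define \<mu> where "\<mu> = ?q v"
  have ge: "\<mu> * inner w w \<le> ?q w" for w
  proof (cases "w = 0")
    case False
    define u where "u = (1 / norm w) *\<^sub>R w"
    have w: "w = norm w *\<^sub>R u" and "norm u = 1" using False by (auto simp: u_def)
    then have "\<mu> \<le> ?q u" using min unfolding \<mu>_def by blast
    then have "(norm w)\<^sup>2 * \<mu> \<le> (norm w)\<^sup>2 * ?q u" by (intro mult_left_mono) auto
    also have "\<dots> = ?q (norm w *\<^sub>R u)"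
      by (simp add: matrix_vector_mult_scaleR power2_eq_square)
    also have "\<dots> = ?q w" using w by simp
    finally show ?thesis by (simp add: power2_norm_eq_inner mult.commute)
  qed simp
  define b where "b w z = inner (A *v w) z - \<mu> * inner w z" for w z
  have "b v w = 0" for w
  proof (rule ccontr)
    assume ne: "b v w \<noteq> 0"
    have b0: "b v v = 0"
      using v by (simp add: b_def \<mu>_def dot_square_norm)
    have sym: "b w v = b v w" 
      using inner_matrix_commute[OF A, of w v] inner_commute[of w "A *v v"] inner_commute[of w v]
      by (simp add: b_def)
    have "0 \<le> 2 * r * b v w + r\<^sup>2 * b w w" for r
    proof -
      have "0 \<le> b (v + r *\<^sub>R w) (v + r *\<^sub>R w)" using ge by (simp add: b_def)
      also have "\<dots> = b v v + r * b v w + r * b w v + r\<^sup>2 * b w w"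
        by (simp add: b_def matrix_vector_right_distrib matrix_vector_mult_scaleR inner_add_left
            inner_add_right algebra_simps power2_eq_square)
      finally show ?thesis by (simp add: b0 sym)
    qed
    note pos = this
    have bw: "0 \<le> b w w" using ge by (simp add: b_def)
    \<comment> \<open>Moving from \<open>v\<close> by \<open>r w\<close> makes the form negative; the summand 1 avoids a division by \<open>b w w = 0\<close>.\<close>
    define r where "r = - b v w / (b w w + 1)"
    have eq: "b v w = - (r * (b w w + 1))" using bw by (simp add: r_def)
    have "2 * r * b v w + r\<^sup>2 * b w w = - (r\<^sup>2 * (b w w + 2))"
      by (simp add: eq power2_eq_square algebra_simps)
    moreover have "r \<noteq> 0" using ne bw by (simp add: r_def)
    then have "r\<^sup>2 * (b w w + 2) > 0" using bw by simp
    ultimately show False using pos[of r] by simp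
  qed
  then have "inner (A *v v - \<mu> *\<^sub>R v) w = 0" for w by (simp add: b_def inner_diff_left)
  then have "A *v v - \<mu> *\<^sub>R v = 0" using inner_eq_zero_iff by blast
  moreover have "v \<noteq> 0" using v by auto
  ultimately show ?thesis using ge that by auto
qed

lemma eigenvectors_orthogonal:
  fixes A :: "real ^ 'n::finite ^ 'n"
  assumes A: "transpose A = A" and "A *v v = \<mu> *\<^sub>R v" "A *v w = \<nu> *\<^sub>R w" "\<mu> \<noteq> \<nu>"
  shows "orthogonal v w"
proof -
  have "\<mu> * inner v w = \<nu> * inner v w"
    using inner_matrix_commute[OF A, of v w] assms by simp
  then show ?thesis using assms(4) by (simp add: orthogonal_def)
qed

text \<open>Eigenvectors for distinct eigenvalues are orthogonal, hence independent.  Finiteness matters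
  because the sum that defines the index would be zero over an infinite set.\<close>

lemma finite_eigenvalues:
  fixes A :: "real ^ 'n::finite ^ 'n"
  assumes A: "transpose A = A"
  shows "finite {\<mu>. \<exists>v. v \<noteq> 0 \<and> A *v v = \<mu> *\<^sub>R v}"
proof -
  define N where "N = {\<mu>. \<exists>v. v \<noteq> 0 \<and> A *v v = \<mu> *\<^sub>R v}"
  have "\<forall>\<mu>\<in>N. \<exists>v. v \<noteq> 0 \<and> A *v v = \<mu> *\<^sub>R v" by (simp add: N_def)
  from bchoice[OF this] obtain f where f: "\<forall>\<mu>\<in>N. f \<mu> \<noteq> 0 \<and> A *v f \<mu> = \<mu> *\<^sub>R f \<mu>" ..
  have nz: "f \<mu> \<noteq> 0" and eig: "A *v f \<mu> = \<mu> *\<^sub>R f \<mu>" if "\<mu> \<in> N" for \<mu>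
    using bspec[OF f that] by (rule conjunct1, rule conjunct2)
  have "pairwise orthogonal (f ` N)"
  proof (rule pairwiseI)
    fix v w assume "v \<in> f ` N" "w \<in> f ` N" "v \<noteq> w"
    then obtain \<mu> \<nu> where "\<mu> \<in> N" "\<nu> \<in> N" "v = f \<mu>" "w = f \<nu>" "\<mu> \<noteq> \<nu>" by blast
    then show "orthogonal v w" using eigenvectors_orthogonal[OF A eig eig] by simp
  qed
  moreover have "0 \<notin> f ` N"
    using nz by (metis imageE)
  ultimately have fin: "finite (f ` N)"
    using pairwise_orthogonal_independent independent_imp_finite by blast
  have "inj_on f N"
  proof (rule inj_onI)
    fix \<mu> \<nu> assume N: "\<mu> \<in> N" "\<nu> \<in> N" and eq: "f \<mu> = f \<nu>"
    have "\<mu> *\<^sub>R f \<nu> = \<nu> *\<^sub>R f \<nu>" using eig[OF N(1)] eig[OF N(2)] unfolding eq by (rule trans[OF sym])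
    then show "\<mu> = \<nu>" using nz[OF N(2)] unfolding scaleR_cancel_right by blast
  qed
  with fin have "finite N" by (rule finite_imageD)
  then show ?thesis by (simp only: N_def)
qed

text \<open>The index counts the members of an orthogonal system of eigenvectors: the union of orthonormal
  bases of the eigenspaces for negative eigenvalues.\<close>

lemma orthogonal_negative_eigenvectors:
  fixes A :: "real ^ 'n::finite ^ 'n"
  assumes A: "transpose A = A"
  obtains S where "finite S" "pairwise orthogonal S" "0 \<notin> S" "card S = matrix_index A"
    "\<And>v. v \<in> S \<Longrightarrow> \<exists>\<mu><0. A *v v = \<mu> *\<^sub>R v"
proof -
  let ?E = "\<lambda>\<mu>. {v. A *v v = \<mu> *\<^sub>R v}"
  define N where "N = {\<mu>. \<mu> < 0 \<and> (\<exists>v. v \<noteq> 0 \<and> A *v v = \<mu> *\<^sub>R v)}"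
  have N: "finite N" using finite_eigenvalues[OF A] by (rule rev_finite_subset) (auto simp: N_def)
  have sub: "subspace (?E \<mu>)" for \<mu>
    by (auto simp: subspace_def matrix_vector_right_distrib matrix_vector_mult_scaleR algebra_simps)
  have "\<exists>B. B \<subseteq> ?E \<mu> \<and> pairwise orthogonal B \<and> 0 \<notin> B \<and> finite B \<and> card B = dim (?E \<mu>)" for \<mu>
  proof -
    obtain B where B: "B \<subseteq> ?E \<mu>" "pairwise orthogonal B" "\<And>x. x \<in> B \<Longrightarrow> norm x = 1"
      "independent B" "card B = dim (?E \<mu>)"
      by (rule orthonormal_basis_subspace[OF sub]) blast
    have "0 \<notin> B" using B(3)[of 0] by auto
    with B independent_imp_finite[OF B(4)] show ?thesis by (intro exI[of _ B]) simp
  qed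
  then have "\<forall>\<mu>. \<exists>B. B \<subseteq> ?E \<mu> \<and> pairwise orthogonal B \<and> 0 \<notin> B \<and> finite B \<and> card B = dim (?E \<mu>)"
    by blast
  from choice[OF this] obtain B
    where B: "B \<mu> \<subseteq> ?E \<mu>" "pairwise orthogonal (B \<mu>)" "0 \<notin> B \<mu>" "finite (B \<mu>)"
      "card (B \<mu>) = dim (?E \<mu>)" for \<mu>
    by blast
  have orth: "orthogonal v w" if "v \<in> B \<mu>" "w \<in> B \<nu>" "\<mu> \<noteq> \<nu>" for \<mu> \<nu> v w
    using eigenvectors_orthogonal[OF A] that B(1) by blast
  show ?thesis
  proof
    show "finite (\<Union>\<mu>\<in>N. B \<mu>)" using N B(4) by blast
    show "pairwise orthogonal (\<Union>\<mu>\<in>N. B \<mu>)"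
    proof (rule pairwiseI)
      fix v w assume "v \<in> (\<Union>\<mu>\<in>N. B \<mu>)" "w \<in> (\<Union>\<mu>\<in>N. B \<mu>)" and ne: "v \<noteq> w"
      then obtain \<mu> \<nu> where "v \<in> B \<mu>" "w \<in> B \<nu>" by blast
      then show "orthogonal v w"
        using orth pairwiseD[OF B(2)] ne by (cases "\<mu> = \<nu>") auto
    qed
    show "0 \<notin> (\<Union>\<mu>\<in>N. B \<mu>)" using B(3) by blast
    have "card (\<Union>\<mu>\<in>N. B \<mu>) = (\<Sum>\<mu>\<in>N. card (B \<mu>))"
    proof (rule card_UN_disjoint[OF N])
      show "\<forall>\<mu>\<in>N. \<forall>\<nu>\<in>N. \<mu> \<noteq> \<nu> \<longrightarrow> B \<mu> \<inter> B \<nu> = {}"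
      proof (intro ballI impI equals0I)
        fix \<mu> \<nu> v assume "\<mu> \<noteq> \<nu>" "v \<in> B \<mu> \<inter> B \<nu>"
        then have "orthogonal v v" using orth by auto
        then show False using \<open>v \<in> B \<mu> \<inter> B \<nu>\<close> B(3) by (auto simp: orthogonal_self)
      qed
    qed (use B(4) in blast)
    then show "card (\<Union>\<mu>\<in>N. B \<mu>) = matrix_index A"
      by (simp add: B(5) matrix_index_def N_def)
    show "\<exists>\<mu><0. A *v v = \<mu> *\<^sub>R v" if "v \<in> (\<Union>\<mu>\<in>N. B \<mu>)" for v
      using that B(1) by (auto simp: N_def)
  qed
qed

text \<open>If the smallest eigenvalue were negative, its eigenspace would contribute to the index; it is
  nonzero because the matrix is nonsingular.\<close>

lemma index_0_imp_positive_definite: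
  fixes A :: "real ^ 'n::finite ^ 'n"
  assumes A: "transpose A = A" and det: "det A \<noteq> 0" and ind: "matrix_index A = 0" and w: "w \<noteq> 0"
  shows "inner (A *v w) w > 0"
proof -
  obtain \<mu> v where v: "v \<noteq> 0" "A *v v = \<mu> *\<^sub>R v" and min: "\<And>w. \<mu> * inner w w \<le> inner (A *v w) w"
    using rayleigh_minimum[OF A] by metis
  have "\<not> \<mu> < 0"
  proof
    assume "\<mu> < 0"
    let ?N = "{\<mu>. \<mu> < 0 \<and> (\<exists>v. v \<noteq> 0 \<and> A *v v = \<mu> *\<^sub>R v)}"
    have "finite ?N" using finite_eigenvalues[OF A] by (rule rev_finite_subset) auto
    then have "\<forall>\<mu>\<in>?N. dim {v. A *v v = \<mu> *\<^sub>R v} = 0"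
      using ind by (simp add: matrix_index_def)
    then have "dim {v. A *v v = \<mu> *\<^sub>R v} = 0" using \<open>\<mu> < 0\<close> v by blast
    then show False using v by (auto simp: dim_eq_0)
  qed
  moreover have "\<mu> \<noteq> 0"
  proof
    assume "\<mu> = 0"
    then have "A *v v = 0" using v by simp
    then show False using v(1) det_nonzero_imp_kernel_0[OF det] by blast
  qed
  ultimately have "0 < \<mu> * inner w w" using w by simp
  then show ?thesis using min[of w] by linarith
qed

text \<open>The Rayleigh minimum of \<open>- A\<close> belongs to the largest eigenvalue of \<open>A\<close>.  If that eigenvalue were
  nonnegative, its eigenvector could be added to the \<open>n\<close> orthogonal eigenvectors for negative
  eigenvalues, giving \<open>n + 1\<close> independent vectors in dimension \<open>n\<close>.\<close>

lemma full_index_imp_negative_definite: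
  fixes A :: "real ^ 'n::finite ^ 'n"
  assumes A: "transpose A = A" and ind: "matrix_index A = CARD('n)" and w: "w \<noteq> 0"
  shows "inner (A *v w) w < 0"
proof -
  have "transpose (- A) = - A" using A by (simp add: transpose_def vec_eq_iff)
  then obtain \<mu> v where v: "v \<noteq> 0" "(- A) *v v = \<mu> *\<^sub>R v"
    and min: "\<And>w. \<mu> * inner w w \<le> inner ((- A) *v w) w"
    using rayleigh_minimum by metis
  have neg: "(- A) *v x = - (A *v x)" for x
    using matrix_vector_mult_diff_rdistrib[of 0 A x] by simp
  have Av: "A *v v = (- \<mu>) *\<^sub>R v" using v(2) neg by (metis minus_minus scaleR_minus_left)
  obtain S where S: "finite S" "pairwise orthogonal S" "0 \<notin> S" "card S = matrix_index A"
    "\<And>v. v \<in> S \<Longrightarrow> \<exists>\<mu><0. A *v v = \<mu> *\<^sub>R v"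
    using orthogonal_negative_eigenvectors[OF A] by metis
  have "\<mu> > 0"
  proof (rule ccontr)
    assume "\<not> \<mu> > 0"
    have orth: "orthogonal v x" if x: "x \<in> S" for x
    proof -
      obtain \<nu> where "\<nu> < 0" "A *v x = \<nu> *\<^sub>R x" using S(5)[OF x] by blast
      then show ?thesis using \<open>\<not> \<mu> > 0\<close> by (intro eigenvectors_orthogonal[OF A Av]) auto
    qed
    then have "v \<notin> S" using v(1) orthogonal_self[of v] by auto
    have "independent (insert v S)"
      using S(2,3) orth v(1)
      by (intro pairwise_orthogonal_independent) (auto simp: pairwise_insert orthogonal_commute)
    then have "card (insert v S) \<le> DIM(real ^ 'n)" by (rule independent_bound[THEN conjunct2])
    then show False using S(1,4) ind \<open>v \<notin> S\<close> by simp
  qed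
  then have "0 < \<mu> * inner w w" using w by simp
  then show ?thesis using min[of w] by (simp add: neg)
qed

section \<open>Curves on intervals and reparametrization\<close>

lemma at_within_interval_neq_bot:
  fixes J :: "real set"
  assumes "is_interval J" "\<nexists>a. J = {a}" "s \<in> J"
  shows "at s within J \<noteq> bot"
  using assms connected_imp_perfect[of J s] trivial_limit_within
  by (auto simp: is_interval_connected_1)

text \<open>One-sided derivatives are unique only where the interval accumulates.  The parameter interval \<open>J\<close>
  of a reparametrization inherits this from \<open>I\<close>: being in bijection with an infinite set, it is not a
  single point.\<close>

lemma reparam_domain_nontrivial:
  fixes \<phi> :: "real \<Rightarrow> real"
  assumes "bij_betw \<phi> J I" "interior I \<noteq> {}" "is_interval J" "s \<in> J"
  shows "at s within J \<noteq> bot"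
proof -
  have "infinite I"
    using finite_imp_not_open[of "interior I"] assms(2) interior_subset finite_subset open_interior
    by metis
  then have "infinite J" using bij_betw_finite[OF assms(1)] by simp
  then have "\<nexists>a. J = {a}" by auto
  then show ?thesis using assms(3,4) by (intro at_within_interval_neq_bot)
qed

lemma velocity_eqI:
  assumes "at s within J \<noteq> bot" "(f has_vector_derivative D) (at s within J)"
  shows "velocity J f s = D"
  unfolding velocity_def using assms by (rule vector_derivative_within)

lemma has_vector_derivative_velocity:
  "f differentiable (at s within J) \<Longrightarrow> (f has_vector_derivative velocity J f s) (at s within J)"
  unfolding velocity_def by (rule vector_derivative_works[THEN iffD1])

lemma C1_onI:
  assumes "\<And>s. s \<in> J \<Longrightarrow> at s within J \<noteq> bot"
    and "\<And>s. s \<in> J \<Longrightarrow> (f has_vector_derivative f1 s) (at s within J)" "continuous_on J f1"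
  shows "C1_on J f"
proof -
  have "continuous_on J (velocity J f)"
    using assms(3) by (rule continuous_on_eq) (rule sym[OF velocity_eqI[OF assms(1,2)]])
  then show ?thesis using assms(2) by (auto simp: C1_on_def intro: differentiableI_vector)
qed

lemma C2_onI:
  assumes nb: "\<And>s. s \<in> J \<Longrightarrow> at s within J \<noteq> bot"
    and f: "\<And>s. s \<in> J \<Longrightarrow> (f has_vector_derivative f1 s) (at s within J)"
    and f1: "\<And>s. s \<in> J \<Longrightarrow> (f1 has_vector_derivative f2 s) (at s within J)" and "continuous_on J f2"
  shows "C2_on J f"
proof -
  have eq: "velocity J f s = f1 s" if "s \<in> J" for s using velocity_eqI nb f that by blast
  have "continuous_on J f1"
    using f1 has_vector_derivative_continuous by (fastforce simp: continuous_on_eq_continuous_within)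
  then have "C1_on J f" using nb f by (rule C1_onI[rotated 2])
  moreover have "C1_on J (velocity J f)"
  proof (rule C1_onI[OF nb _ assms(4)])
    fix s assume "s \<in> J"
    then show "(velocity J f has_vector_derivative f2 s) (at s within J)"
      using f1[of s] eq by (auto intro: has_vector_derivative_transform)
  qed
  ultimately show ?thesis by (simp add: C2_on_def)
qed

lemma C2_onD:
  assumes "C2_on J f"
  shows "s \<in> J \<Longrightarrow> (f has_vector_derivative velocity J f s) (at s within J)"
    and "s \<in> J \<Longrightarrow> (velocity J f has_vector_derivative velocity J (velocity J f) s) (at s within J)"
    and "continuous_on J f" "continuous_on J (velocity J f)" "continuous_on J (velocity J (velocity J f))"
  using assms unfolding C2_on_def C1_on_def
  by (auto intro: has_vector_derivative_velocity differentiable_imp_continuous_on simp: differentiable_on_def)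

lemma has_vector_derivative_reparam:
  assumes "\<phi> ` J = I" "s \<in> J"
    and "\<alpha> differentiable (at (\<phi> s) within I)" "\<phi> differentiable (at s within J)"
  shows "((\<alpha> \<circ> \<phi>) has_vector_derivative velocity J \<phi> s *\<^sub>R velocity I \<alpha> (\<phi> s)) (at s within J)"
  using vector_derivative_diff_chain_within[OF has_vector_derivative_velocity, of \<phi> s J \<alpha>
      "\<lambda>r. r *\<^sub>R velocity I \<alpha> (\<phi> s)"] assms has_vector_derivative_velocity[OF assms(3)]
  by (simp add: has_vector_derivative_def)

text \<open>The interval may be open, closed or unbounded at either end, whereas the fundamental theorem of
  calculus speaks of compact intervals.  Every point \<open>u\<close> has a compact subinterval containing a base
  point \<open>u0\<close> which agrees with \<open>I\<close> near \<open>u\<close>, so that derivatives at \<open>u\<close> within either set coincide.\<close>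

lemma interval_relative_neighbourhood:
  fixes I :: "real set"
  assumes "is_interval I" "u \<in> I" "u0 \<in> I"
  obtains a b S where "{a..b} \<subseteq> I" "a \<le> u0" "u0 \<le> b" "a \<le> u" "u \<le> b" "open S" "u \<in> S" "I \<inter> S \<subseteq> {a..b}"
proof -
  obtain a L where a: "a \<in> I" "a \<le> u0" "a \<le> u" "open L" "u \<in> L" "\<And>x. x \<in> I \<inter> L \<Longrightarrow> a \<le> x"
  proof (cases "\<exists>x\<in>I. x < u")
    case True
    then obtain x where "x \<in> I" "x < u" by blast
    then show ?thesis using assms by (intro that[of "min x u0" "{x<..}"]) (simp_all add: min_def)
  next
    case False
    then have "u \<le> x" if "x \<in> I" for x using that linorder_not_less by blast
    then show ?thesis using assms by (intro that[of u UNIV]) simp_all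
  qed
  obtain b R where b: "b \<in> I" "u0 \<le> b" "u \<le> b" "open R" "u \<in> R" "\<And>x. x \<in> I \<inter> R \<Longrightarrow> x \<le> b"
  proof (cases "\<exists>x\<in>I. u < x")
    case True
    then obtain x where "x \<in> I" "u < x" by blast
    then show ?thesis using assms by (intro that[of "max x u0" "{..<x}"]) (simp_all add: max_def)
  next
    case False
    then have "x \<le> u" if "x \<in> I" for x using that linorder_not_less by blast
    then show ?thesis using assms by (intro that[of u UNIV]) simp_all
  qed
  have "{a..b} \<subseteq> I" using mem_is_interval_1_I[OF assms(1) a(1) b(1)] by auto
  then show ?thesis using a b by (intro that[of a b "L \<inter> R"]) auto
qed

lemma interval_antiderivative:
  fixes v :: "real \<Rightarrow> real"
  assumes I: "is_interval I" and v: "continuous_on I v"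
  obtains \<psi> where "\<And>u. u \<in> I \<Longrightarrow> (\<psi> has_real_derivative v u) (at u within I)"
proof (cases "I = {}")
  case True
  then show ?thesis using that by simp
next
  case False
  then obtain u0 where u0: "u0 \<in> I" by blast
  show ?thesis
  proof
    fix u assume u: "u \<in> I"
    obtain a b S where ab: "{a..b} \<subseteq> I" "a \<le> u0" "u0 \<le> b" "a \<le> u" "u \<le> b"
      and S: "open S" "u \<in> S" "I \<inter> S \<subseteq> {a..b}"
      using interval_relative_neighbourhood[OF I u u0] by metis
    have "((\<lambda>u. LBINT y=u0..u. v y) has_vector_derivative v u) (at u within {a..b})"
      using ab by (intro interval_integral_FTC2 continuous_on_subset[OF v])
    moreover have "at u within {a..b} = at u within I"
      using S ab(1) by (intro at_within_nhd[of u S]) auto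
    ultimately show "((\<lambda>u. LBINT y=u0..u. v y) has_real_derivative v u) (at u within I)"
      by (simp add: has_real_derivative_iff_has_vector_derivative)
  qed
qed

text \<open>An antiderivative \<open>\<psi>\<close> of the speed \<open>v > 0\<close> is strictly increasing, and its inverse \<open>\<phi>\<close> is the
  reparametrization.  The inverse function theorem gives \<open>\<phi>' = 1 / v(\<phi>)\<close>, and this is again
  differentiable with derivative \<open>- v'(\<phi>) / v(\<phi>)\<^sup>3\<close>, which is why the speed has to be of class
  \<open>C\<^sup>1\<close>.\<close>

lemma reparametrization_of_given_speed:
  fixes v :: "real \<Rightarrow> real"
  assumes I: "is_interval I" "interior I \<noteq> {}" and pos: "\<And>u. u \<in> I \<Longrightarrow> v u > 0"
    and dv: "\<And>u. u \<in> I \<Longrightarrow> (v has_real_derivative v' u) (at u within I)" and cv': "continuous_on I v'"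
  obtains J \<phi> where "is_interval J" "bij_betw \<phi> J I" "C2_on J \<phi>"
    "\<And>s. s \<in> J \<Longrightarrow> velocity J \<phi> s = 1 / v (\<phi> s)"
proof -
  have cv: "continuous_on I v"
    using dv by (rule DERIV_continuous_on)
  obtain \<psi> where \<psi>: "\<And>u. u \<in> I \<Longrightarrow> (\<psi> has_real_derivative v u) (at u within I)"
    using interval_antiderivative[OF I(1) cv] by metis
  have c\<psi>: "continuous_on I \<psi>"
    using \<psi> by (rule DERIV_continuous_on)
  have less: "\<psi> x < \<psi> y" if xy: "x \<in> I" "y \<in> I" "x < y" for x y
  proof (rule DERIV_pos_imp_increasing_open[OF xy(3)])
    have sub: "{x..y} \<subseteq> I" using mem_is_interval_1_I[OF I(1) xy(1,2)] by auto
    show "continuous_on {x..y} \<psi>" using c\<psi> sub continuous_on_subset by blast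
    fix z assume z: "x < z" "z < y"
    then have "z \<in> I" using sub by auto
    have "(\<psi> has_real_derivative v z) (at z within {x<..<y})"
      by (rule has_field_derivative_subset[OF \<psi>[OF \<open>z \<in> I\<close>]]) (use sub in auto)
    then show "\<exists>D. (\<psi> has_real_derivative D) (at z) \<and> D > 0"
      using z pos[OF \<open>z \<in> I\<close>] at_within_open[of z "{x<..<y}"] by auto
  qed
  have inj: "inj_on \<psi> I"
    using less by (metis inj_onI less_irrefl linorder_neqE_linordered_idom)
  define J where "J = \<psi> ` I"
  obtain \<phi> where hom: "homeomorphism I J \<psi> \<phi>"
    using homeomorphism_into_1d[OF _ c\<psi> J_def[symmetric] inj] I(1)
    by (metis convex_imp_path_connected is_interval_convex)
  have \<phi>\<psi>: "\<phi> (\<psi> u) = u" if "u \<in> I" for u using hom that by (simp add: homeomorphism_def)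
  have im: "\<phi> ` J = I" and c\<phi>: "continuous_on J \<phi>" using hom by (simp_all add: homeomorphism_def)
  have inJ: "\<phi> s \<in> I" if "s \<in> J" for s using im that by blast
  have "bij_betw \<phi> J I"
    using hom by (metis bij_betw_def homeomorphism_def inj_on_inverseI)
  have J: "is_interval J"
    unfolding J_def is_interval_connected_1
    using I(1) c\<psi> by (intro connected_continuous_image) (simp_all add: is_interval_connected_1)
  have nb: "at s within J \<noteq> bot" if "s \<in> J" for s
    using reparam_domain_nontrivial[OF \<open>bij_betw \<phi> J I\<close> I(2) J that] .
  have d\<phi>: "(\<phi> has_real_derivative 1 / v (\<phi> s)) (at s within J)" if s: "s \<in> J" for s
  proof -
    obtain u where u: "u \<in> I" "s = \<psi> u" using s J_def by blast
    have "(\<phi> has_derivative (\<lambda>x. x / v u)) (at (\<psi> u) within \<psi> ` I)"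
    proof (rule has_derivative_inverse_within[OF \<psi>[OF u(1), unfolded has_field_derivative_def] _ u(1)])
      show "continuous (at (\<psi> u) within \<psi> ` I) \<phi>"
        using c\<phi> s unfolding u(2) J_def continuous_on_eq_continuous_within by (rule bspec)
      show "linear (\<lambda>x. x / v u)" by (intro linearI) (simp_all add: add_divide_distrib)
      show "(\<lambda>x. x / v u) \<circ> (*) (v u) = id" using pos[OF u(1)] by auto
    qed (rule \<phi>\<psi>)
    then show ?thesis
      using u by (simp add: J_def[symmetric] \<phi>\<psi> has_field_derivative_def divide_inverse mult.commute[of _ "inverse _"])
  qed
  have dv\<phi>: "((\<lambda>s. v (\<phi> s)) has_real_derivative v' (\<phi> s) * (1 / v (\<phi> s))) (at s within J)" if s: "s \<in> J" for s
    using DERIV_image_chain[OF _ d\<phi>[OF s], of v "v' (\<phi> s)"] dv[OF inJ[OF s]] by (simp add: im o_def)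
  have nz: "v (\<phi> s) \<noteq> 0" if "s \<in> J" for s using pos[OF inJ[OF that]] by simp
  have "C2_on J \<phi>"
  proof (rule C2_onI[OF nb])
    show "(\<phi> has_vector_derivative 1 / v (\<phi> s)) (at s within J)" if "s \<in> J" for s
      using d\<phi>[OF that] by (simp add: has_real_derivative_iff_has_vector_derivative)
    show "((\<lambda>s. 1 / v (\<phi> s)) has_vector_derivative - v' (\<phi> s) / v (\<phi> s) ^ 3) (at s within J)" if s: "s \<in> J" for s
      unfolding has_real_derivative_iff_has_vector_derivative[symmetric]
      by (rule derivative_eq_intros dv\<phi>[OF s] refl nz[OF s])+
        (use nz[OF s] in \<open>simp add: field_simps power3_eq_cube\<close>)
    have "continuous_on J (\<lambda>s. v (\<phi> s))" "continuous_on J (\<lambda>s. v' (\<phi> s))"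
      using continuous_on_compose2[OF cv c\<phi>] continuous_on_compose2[OF cv' c\<phi>] im by simp_all
    then show "continuous_on J (\<lambda>s. - v' (\<phi> s) / v (\<phi> s) ^ 3)"
      using nz by (intro continuous_intros) auto
  qed
  moreover have "velocity J \<phi> s = 1 / v (\<phi> s)" if "s \<in> J" for s
    using velocity_eqI[OF nb[OF that]] d\<phi>[OF that]
    by (simp add: has_real_derivative_iff_has_vector_derivative)
  ultimately show ?thesis using that J \<open>bij_betw \<phi> J I\<close> by blast
qed

section \<open>Metrics along curves and arc length\<close>

text \<open>The metric is described by its values on constant vectors, as functions of the point: these are the
  coefficients of the metric, here assumed to be of class \<open>C\<^sup>1\<close>.\<close>

locale C1_metric =
  fixes U :: "(real ^ 'n::finite) set" and g :: "'n metric"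
  assumes open_U: "open U"
    and bilinear_metric: "q \<in> U \<Longrightarrow> bilinear (g q)"
    and differentiable_metric: "q \<in> U \<Longrightarrow> (\<lambda>x. g x v w) differentiable (at q)"
    and continuous_metric_derivative:
      "continuous_on U (\<lambda>q. frechet_derivative (\<lambda>x. g x v w) (at q) u)"
begin

abbreviation dg where "dg q v w u \<equiv> frechet_derivative (\<lambda>x. g x v w) (at q) u"

lemma has_derivative_metric: "q \<in> U \<Longrightarrow> ((\<lambda>x. g x v w) has_derivative dg q v w) (at q)"
  using differentiable_metric frechet_derivative_works by blast

lemma linear_dg: "q \<in> U \<Longrightarrow> linear (dg q v w)"
  using differentiable_metric linear_frechet_derivative by blast

lemma metric_expand:
  "q \<in> U \<Longrightarrow> g q v w = (\<Sum>i\<in>UNIV. \<Sum>j\<in>UNIV. v $ i * w $ j * g q (axis i 1) (axis j 1))"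
  by (rule bilinear_expand_axis[OF bilinear_metric])

text \<open>The derivative of the metric inherits bilinearity in the two vectors by differentiating the
  expansion of \<open>g\<close> in the standard basis; the expansion is available near \<open>q\<close> because \<open>U\<close> is
  open.\<close>

lemma dg_expand:
  assumes q: "q \<in> U"
  shows "dg q v w u = (\<Sum>i\<in>UNIV. \<Sum>j\<in>UNIV. v $ i * w $ j * dg q (axis i 1) (axis j 1) u)"
proof -
  have "((\<lambda>x. \<Sum>i\<in>UNIV. \<Sum>j\<in>UNIV. v $ i * w $ j * g x (axis i 1) (axis j 1)) has_derivative
      (\<lambda>u. \<Sum>i\<in>UNIV. \<Sum>j\<in>UNIV. v $ i * w $ j * dg q (axis i 1) (axis j 1) u)) (at q)"
    by (intro has_derivative_sum has_derivative_mult_right has_derivative_metric q)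
  then have "((\<lambda>x. g x v w) has_derivative
      (\<lambda>u. \<Sum>i\<in>UNIV. \<Sum>j\<in>UNIV. v $ i * w $ j * dg q (axis i 1) (axis j 1) u)) (at q)"
    by (rule has_derivative_transform_within_open[OF _ open_U q]) (rule metric_expand[symmetric])
  from fun_cong[OF frechet_derivative_at[OF this], of u] show ?thesis by (rule sym)
qed

text \<open>The product rule for \<open>g(V, W)\<close> along a curve, before any connection is chosen: expand in the
  standard basis and differentiate coefficients and components separately.\<close>

lemma has_real_derivative_metric_along:
  assumes \<beta>: "\<And>s. s \<in> J \<Longrightarrow> \<beta> s \<in> U" and s: "s \<in> J"
    and d\<beta>: "(\<beta> has_vector_derivative \<beta>') (at s within J)"
    and dV: "(V has_vector_derivative V') (at s within J)"
    and dW: "(W has_vector_derivative W') (at s within J)"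
  shows "((\<lambda>s. g (\<beta> s) (V s) (W s)) has_real_derivative
    dg (\<beta> s) (V s) (W s) \<beta>' + g (\<beta> s) V' (W s) + g (\<beta> s) (V s) W') (at s within J)"
proof -
  note bU = \<beta>[OF s]
  have comp: "((\<lambda>s. X s $ i) has_real_derivative X' $ i) (at s within J)"
    if "(X has_vector_derivative X') (at s within J)" for X X' i
    using bounded_linear.has_vector_derivative[OF bounded_linear_vec_nth that]
    by (simp add: has_real_derivative_iff_has_vector_derivative)
  have coef: "((\<lambda>s. g (\<beta> s) v w) has_real_derivative dg (\<beta> s) v w \<beta>') (at s within J)" for v w
    using has_derivative_compose[OF d\<beta>[unfolded has_vector_derivative_def] has_derivative_metric[OF bU, of v w]]
    by (simp add: has_field_derivative_def linear_cmul[OF linear_dg[OF bU]] mult_commute_abs)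
  let ?e = "\<lambda>i. axis i 1 :: real ^ 'n"
  have "((\<lambda>s. \<Sum>i\<in>UNIV. \<Sum>j\<in>UNIV. V s $ i * W s $ j * g (\<beta> s) (?e i) (?e j)) has_real_derivative
      (\<Sum>i\<in>UNIV. \<Sum>j\<in>UNIV. (V' $ i * W s $ j + W' $ j * V s $ i) * g (\<beta> s) (?e i) (?e j)
        + dg (\<beta> s) (?e i) (?e j) \<beta>' * (V s $ i * W s $ j))) (at s within J)"
    by (intro DERIV_sum DERIV_mult comp dV dW coef)
  moreover have "(\<Sum>i\<in>UNIV. \<Sum>j\<in>UNIV. (V' $ i * W s $ j + W' $ j * V s $ i) * g (\<beta> s) (?e i) (?e j)
        + dg (\<beta> s) (?e i) (?e j) \<beta>' * (V s $ i * W s $ j))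
      = dg (\<beta> s) (V s) (W s) \<beta>' + g (\<beta> s) V' (W s) + g (\<beta> s) (V s) W'"
    unfolding metric_expand[OF bU, of V' "W s"] metric_expand[OF bU, of "V s" W'] dg_expand[OF bU, of "V s" "W s"]
    by (simp add: sum.distrib algebra_simps)
  ultimately have "((\<lambda>s. \<Sum>i\<in>UNIV. \<Sum>j\<in>UNIV. V s $ i * W s $ j * g (\<beta> s) (?e i) (?e j)) has_real_derivative
      dg (\<beta> s) (V s) (W s) \<beta>' + g (\<beta> s) V' (W s) + g (\<beta> s) (V s) W') (at s within J)"
    by simp
  then show ?thesis
    unfolding has_real_derivative_iff_has_vector_derivative
    by (rule has_vector_derivative_transform[OF s, rotated]) (rule metric_expand[OF \<beta>])
qed

lemma continuous_on_metric_along: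
  assumes \<beta>: "\<beta> ` J \<subseteq> U" and c: "continuous_on J \<beta>" "continuous_on J V" "continuous_on J W"
  shows "continuous_on J (\<lambda>s. g (\<beta> s) (V s) (W s))"
proof -
  have "continuous_on U (\<lambda>q. g q v w)" for v w
    by (intro continuous_at_imp_continuous_on ballI differentiable_imp_continuous_within differentiable_metric)
  then have "continuous_on J (\<lambda>s. g (\<beta> s) v w)" for v w
    using continuous_on_compose2[OF _ c(1) \<beta>] by blast
  then have "continuous_on J (\<lambda>s. \<Sum>i\<in>UNIV. \<Sum>j\<in>UNIV. V s $ i * W s $ j * g (\<beta> s) (axis i 1) (axis j 1))"
    by (intro continuous_intros c)
  then show ?thesis by (rule continuous_on_eq) (use \<beta> in \<open>auto simp: metric_expand\<close>)
qed

lemma continuous_on_dg_along: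
  assumes \<beta>: "\<beta> ` J \<subseteq> U"
    and c: "continuous_on J \<beta>" "continuous_on J V" "continuous_on J W" "continuous_on J X"
  shows "continuous_on J (\<lambda>s. dg (\<beta> s) (V s) (W s) (X s))"
proof -
  have "continuous_on J (\<lambda>s. dg (\<beta> s) v w u)" for v w u
    using continuous_on_compose2[OF continuous_metric_derivative c(1) \<beta>] by blast
  then have "continuous_on J (\<lambda>s. \<Sum>i\<in>UNIV. \<Sum>j\<in>UNIV. V s $ i * W s $ j *
      (\<Sum>k\<in>UNIV. X s $ k *\<^sub>R dg (\<beta> s) (axis i 1) (axis j 1) (axis k 1)))"
    by (intro continuous_intros c)
  then show ?thesis
  proof (rule continuous_on_eq)
    fix s assume "s \<in> J"
    then have "\<beta> s \<in> U" using \<beta> by auto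
    note lin = linear_expand_axis[OF linear_dg[OF this], symmetric]
    show "(\<Sum>i\<in>UNIV. \<Sum>j\<in>UNIV. V s $ i * W s $ j *
        (\<Sum>k\<in>UNIV. X s $ k *\<^sub>R dg (\<beta> s) (axis i 1) (axis j 1) (axis k 1))) = dg (\<beta> s) (V s) (W s) (X s)"
      unfolding lin using dg_expand[OF \<open>\<beta> s \<in> U\<close>] by (rule sym)
  qed
qed

text \<open>The function \<open>E = g(\<alpha>', \<alpha>')\<close> is continuous and nowhere zero on an interval, so it has a constant
  sign \<open>\<epsilon>\<close>.  The speed \<open>\<surd>(\<epsilon> E)\<close> is therefore positive, and it is of class \<open>C\<^sup>1\<close> by the product rule
  because \<open>\<alpha>\<close> is of class \<open>C\<^sup>2\<close>.\<close>

lemma arclength_reparam_exists: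
  assumes curve: "regular_C2_curve I \<alpha>" and \<alpha>: "\<alpha> ` I \<subseteq> U"
    and ne: "\<And>u. u \<in> I \<Longrightarrow> g (\<alpha> u) (velocity I \<alpha> u) (velocity I \<alpha> u) \<noteq> 0"
  shows "\<exists>J \<phi> \<epsilon>. arclength_reparam g I \<alpha> J \<phi> \<epsilon>"
proof -
  let ?v = "velocity I \<alpha>" and ?a = "velocity I (velocity I \<alpha>)"
  have I: "is_interval I" "interior I \<noteq> {}" and C2: "C2_on I \<alpha>"
    using curve by (auto simp: regular_C2_curve_def)
  note d = C2_onD[OF C2]
  define E where "E u = g (\<alpha> u) (?v u) (?v u)" for u
  define E' where "E' u = dg (\<alpha> u) (?v u) (?v u) (?v u) + g (\<alpha> u) (?a u) (?v u) + g (\<alpha> u) (?v u) (?a u)" for u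
  have dE: "(E has_real_derivative E' u) (at u within I)" if "u \<in> I" for u
    unfolding E_def[abs_def] E'_def
    using \<alpha> that by (intro has_real_derivative_metric_along d) auto
  have cE: "continuous_on I E"
    unfolding E_def[abs_def] by (intro continuous_on_metric_along \<alpha> d)
  have cE': "continuous_on I E'"
    unfolding E'_def[abs_def]
    by (intro continuous_on_add continuous_on_metric_along continuous_on_dg_along \<alpha> d)
  have neE: "E u \<noteq> 0" if "u \<in> I" for u using ne that by (simp add: E_def)
  obtain u0 where u0: "u0 \<in> I" using I(2) interior_subset by blast
  define \<epsilon> where "\<epsilon> = sgn (E u0)"
  have \<epsilon>: "\<epsilon> \<in> {-1, 1}" using neE[OF u0] by (auto simp: \<epsilon>_def sgn_if)
  have conn: "is_interval (E ` I)"
    using I(1) cE by (simp add: is_interval_connected_1 connected_continuous_image)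
  have "0 \<notin> E ` I" using neE by auto
  have pos: "\<epsilon> * E u > 0" if u: "u \<in> I" for u
  proof (rule ccontr)
    assume "\<not> \<epsilon> * E u > 0"
    then have "(E u0 \<le> 0 \<and> 0 \<le> E u) \<or> (E u \<le> 0 \<and> 0 \<le> E u0)"
      using neE[OF u0] by (auto simp: \<epsilon>_def sgn_if zero_less_mult_iff split: if_splits)
    then have "0 \<in> E ` I"
      using mem_is_interval_1_I[OF conn imageI[OF u] imageI[OF u0]]
        mem_is_interval_1_I[OF conn imageI[OF u0] imageI[OF u]] by blast
    then show False using \<open>0 \<notin> E ` I\<close> by blast
  qed
  obtain J \<phi> where J: "is_interval J" "bij_betw \<phi> J I" "C2_on J \<phi>"
    and vel: "\<And>s. s \<in> J \<Longrightarrow> velocity J \<phi> s = 1 / sqrt (\<epsilon> * E (\<phi> s))"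
  proof (rule reparametrization_of_given_speed[OF I, of "\<lambda>u. sqrt (\<epsilon> * E u)" "\<lambda>u. \<epsilon> * E' u / (2 * sqrt (\<epsilon> * E u))"])
    show "sqrt (\<epsilon> * E u) > 0" if "u \<in> I" for u using pos[OF that] by simp
    show "((\<lambda>u. sqrt (\<epsilon> * E u)) has_real_derivative \<epsilon> * E' u / (2 * sqrt (\<epsilon> * E u))) (at u within I)"
      if u: "u \<in> I" for u
    proof -
      have "(sqrt has_real_derivative inverse (sqrt (\<epsilon> * E u)) / 2) (at (\<epsilon> * E u))"
        using pos[OF u] by (rule DERIV_real_sqrt)
      from DERIV_chain2[OF this DERIV_cmult[OF dE[OF u], of \<epsilon>]]
      show ?thesis by (simp add: field_simps)
    qed
    show "continuous_on I (\<lambda>u. \<epsilon> * E' u / (2 * sqrt (\<epsilon> * E u)))"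
      using \<epsilon> neE by (intro continuous_intros cE cE') auto
    fix J \<phi>
    assume "is_interval J" "bij_betw \<phi> J I" "C2_on J \<phi>"
      "\<And>s. s \<in> J \<Longrightarrow> velocity J \<phi> s = 1 / sqrt (\<epsilon> * E (\<phi> s))"
    then show thesis by (rule that)
  qed
  have im: "\<phi> ` J = I" using J(2) by (simp add: bij_betw_def)
  have inI: "\<phi> s \<in> I" if "s \<in> J" for s using im that by blast
  have nb: "at s within J \<noteq> bot" if "s \<in> J" for s
    using reparam_domain_nontrivial[OF J(2) I(2) J(1) that] .
  have unit: "g (\<alpha> (\<phi> s)) (velocity J (\<alpha> \<circ> \<phi>) s) (velocity J (\<alpha> \<circ> \<phi>) s) = \<epsilon>" if s: "s \<in> J" for s
  proof -
    have "((\<alpha> \<circ> \<phi>) has_vector_derivative velocity J \<phi> s *\<^sub>R ?v (\<phi> s)) (at s within J)"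
      using im s d(1)[OF inI[OF s]] C2_onD(1)[OF J(3) s]
      by (intro has_vector_derivative_reparam) (auto intro: differentiableI_vector)
    then have v: "velocity J (\<alpha> \<circ> \<phi>) s = (1 / sqrt (\<epsilon> * E (\<phi> s))) *\<^sub>R ?v (\<phi> s)"
      using velocity_eqI[OF nb[OF s]] vel[OF s] by simp
    have "\<alpha> (\<phi> s) \<in> U" using inI[OF s] \<alpha> by auto
    note b = bilinear_metric[OF this]
    have "g (\<alpha> (\<phi> s)) (velocity J (\<alpha> \<circ> \<phi>) s) (velocity J (\<alpha> \<circ> \<phi>) s)
        = E (\<phi> s) / (sqrt (\<epsilon> * E (\<phi> s)) * sqrt (\<epsilon> * E (\<phi> s)))"
      unfolding v by (simp add: bilinear_lmul[OF b] bilinear_rmul[OF b] E_def)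
    also have "\<dots> = E (\<phi> s) / (\<epsilon> * E (\<phi> s))" using pos[OF inI[OF s]] by simp
    also have "\<dots> = \<epsilon>" using neE[OF inI[OF s]] \<epsilon> by auto
    finally show ?thesis .
  qed
  have "velocity J \<phi> s \<noteq> 0" if "s \<in> J" for s using vel[OF that] neE[OF inI[OF that]] \<epsilon> by auto
  then have "arclength_reparam g I \<alpha> J \<phi> \<epsilon>"
    unfolding arclength_reparam_def using J \<epsilon> unit by blast
  then show ?thesis by blast
qed

end

section \<open>Metric connections and the gradient\<close>

lemma differentiable_det:
  fixes A :: "'a::real_normed_vector \<Rightarrow> real ^ 'n::finite ^ 'n"
  assumes "\<And>i j. (\<lambda>x. A x $ i $ j) differentiable (at a within S)"
  shows "(\<lambda>x. det (A x)) differentiable (at a within S)"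
  unfolding det_def
  by (intro differentiable_sum differentiable_mult differentiable_prod_finite differentiable_const
      finite_permutations ballI assms) simp_all

text \<open>Cramer's rule expresses the solution of a nonsingular linear system as a quotient of determinants,
  which are polynomials in the entries.  This makes the gradient with respect to a metric
  differentiable.\<close>

lemma differentiable_linear_solution:
  fixes A :: "'a::real_normed_vector \<Rightarrow> real ^ 'n::finite ^ 'n" and b w :: "'a \<Rightarrow> real ^ 'n"
  assumes U: "open U" "q \<in> U"
    and A: "\<And>i j. (\<lambda>x. A x $ i $ j) differentiable (at q)"
    and b: "\<And>i. (\<lambda>x. b x $ i) differentiable (at q)"
    and det: "\<And>x. x \<in> U \<Longrightarrow> det (A x) \<noteq> 0"
    and sol: "\<And>x. x \<in> U \<Longrightarrow> A x *v w x = b x"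
  shows "w differentiable (at q)"
proof -
  let ?c = "\<lambda>x. \<chi> k. det (\<chi> i j. if j = k then b x $ i else A x $ i $ j) / det (A x)"
  have w: "w x = ?c x" if "x \<in> U" for x
    using cramer[OF det[OF that]] sol[OF that] by blast
  have "(\<lambda>x. (\<chi> i j. if j = k then b x $ i else A x $ i $ j) $ i $ j) differentiable (at q)" for i j k
    using A b by (cases "j = k") simp_all
  then have "(\<lambda>x. ?c x $ k) differentiable (at q)" for k
    by (simp only: vec_lambda_beta[of _ k])
      (intro differentiable_divide differentiable_det A det U(2); assumption)
  then have "?c differentiable (at q)" by (rule differentiable_vec_nth)
  then obtain D where "(?c has_derivative D) (at q)" unfolding differentiable_def by blast
  then have "(w has_derivative D) (at q)"
    by (rule has_derivative_transform_within_open[OF _ U]) (rule w[symmetric])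
  then show ?thesis unfolding differentiable_def by blast
qed

text \<open>Constant vector fields are smooth and have zero derivative, so evaluating the compatibility of a
  Levi-Civita connection on them leaves exactly the Christoffel terms.\<close>

lemma levi_civita_imp_metric_compatible:
  assumes "levi_civita U g \<Gamma>" "q \<in> U"
  shows "frechet_derivative (\<lambda>x. g x v w) (at q) u = g q (\<Gamma> q u v) w + g q v (\<Gamma> q u w)"
proof -
  have "frechet_derivative (\<lambda>x. g x ((\<lambda>_. v) x) ((\<lambda>_. w) x)) (at q) ((\<lambda>_. u) q) =
      g q (cov_deriv \<Gamma> (\<lambda>_. v) q ((\<lambda>_. u) q)) ((\<lambda>_. w) q)
      + g q ((\<lambda>_. v) q) (cov_deriv \<Gamma> (\<lambda>_. w) q ((\<lambda>_. u) q))"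
    using assms smooth_on_const unfolding levi_civita_def by blast
  then show ?thesis by (simp add: cov_deriv_def)
qed

text \<open>Compatibility is recorded for constant fields; the product rules below extend it to fields along
  curves that are merely differentiable.\<close>

locale metric_connection = C1_metric U g
  for U :: "(real ^ 'n::finite) set" and g :: "'n metric" +
  fixes \<Gamma> :: "'n christoffel"
  assumes symmetric_metric: "q \<in> U \<Longrightarrow> g q v w = g q w v"
    and nondegenerate_metric: "q \<in> U \<Longrightarrow> (\<And>z. g q w z = 0) \<Longrightarrow> w = 0"
    and metric_compatible:
      "q \<in> U \<Longrightarrow> frechet_derivative (\<lambda>x. g x v w) (at q) u = g q (\<Gamma> q u v) w + g q v (\<Gamma> q u w)"
begin

text \<open>Compatibility replaces the derivative of the coefficients of \<open>g\<close> by the two Christoffel terms that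
  complete the ordinary derivatives of \<open>V\<close> and \<open>W\<close> to covariant ones.\<close>

lemma has_real_derivative_metric_cov:
  assumes \<beta>: "\<And>s. s \<in> J \<Longrightarrow> \<beta> s \<in> U" and s: "s \<in> J"
    and d: "\<beta> differentiable (at s within J)" "V differentiable (at s within J)"
      "W differentiable (at s within J)"
  shows "((\<lambda>s. g (\<beta> s) (V s) (W s)) has_real_derivative
    g (\<beta> s) (cov_deriv_along \<Gamma> J \<beta> V s) (W s) + g (\<beta> s) (V s) (cov_deriv_along \<Gamma> J \<beta> W s)) (at s within J)"
proof -
  note b = bilinear_metric[OF \<beta>[OF s]]
  show ?thesis
    using has_real_derivative_metric_along[OF \<beta> s d[THEN has_vector_derivative_velocity]]
    by (simp add: metric_compatible[OF \<beta>[OF s]] cov_deriv_along_def bilinear_ladd[OF b]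
        bilinear_radd[OF b] add_ac)
qed

text \<open>The definite description in the definition of the gradient is meaningful: nondegeneracy yields both
  existence and uniqueness of the representing vector.\<close>

lemma metric_metric_grad:
  assumes q: "q \<in> U" and F: "F differentiable (at q)"
  shows "g q (metric_grad g F q) v = frechet_derivative F (at q) v"
proof -
  have "\<exists>!w. \<forall>v. g q w v = frechet_derivative F (at q) v"
  proof (rule ex_ex1I)
    show "\<exists>w. \<forall>v. g q w v = frechet_derivative F (at q) v"
      by (rule riesz_nondegenerate[OF bilinear_metric[OF q] nondegenerate_metric[OF q]
            linear_frechet_derivative[OF F]])
    fix w w' assume "\<forall>v. g q w v = frechet_derivative F (at q) v" "\<forall>v. g q w' v = frechet_derivative F (at q) v"
    then have "g q (w - w') z = 0" for z by (simp add: bilinear_lsub[OF bilinear_metric[OF q]])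
    then have "w - w' = 0" by (rule nondegenerate_metric[OF q])
    then show "w = w'" by simp
  qed
  from theI'[OF this] show ?thesis unfolding metric_grad_def by blast
qed

text \<open>In coordinates the gradient solves the linear system whose matrix is the Gram matrix of \<open>g\<close> and
  whose right-hand side consists of the partial derivatives of \<open>F\<close>.\<close>

lemma differentiable_metric_grad:
  assumes F: "smooth_on U F" and q: "q \<in> U"
  shows "metric_grad g F differentiable (at q)"
proof (rule differentiable_linear_solution[OF open_U q])
  let ?A = "\<lambda>x. \<chi> i j. g x (axis j 1) (axis i 1)"
  let ?b = "\<lambda>x. \<chi> i. partial i F x"
  have mult: "?A x *v w = (\<chi> i. g x w (axis i 1))" if x: "x \<in> U" for x w
  proof -
    have "linear (\<lambda>w. g x w z)" for z using bilinear_metric[OF x] by (simp add: bilinear_def)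
    from linear_expand_axis[OF this, where v = w]
    have "(\<Sum>j\<in>UNIV. g x (axis j 1) z * w $ j) = g x w z" for z by (simp add: mult.commute)
    then show ?thesis by (simp add: matrix_vector_mult_def vec_eq_iff)
  qed
  show "(\<lambda>x. ?A x $ i $ j) differentiable (at q)" for i j
    by (simp add: differentiable_metric q)
  show "(\<lambda>x. ?b x $ i) differentiable (at q)" for i
    by (simp add: smooth_on_imp_differentiable[OF smooth_on_partial[OF F] q])
  show "det (?A x) \<noteq> 0" if x: "x \<in> U" for x
  proof -
    have "w = 0" if "?A x *v w = 0" for w
    proof (rule nondegenerate_metric[OF x])
      fix z
      have "g x w (axis i 1) = 0" for i
        using that unfolding mult[OF x] by (simp add: vec_eq_iff)
      moreover have "linear (g x w)" using bilinear_metric[OF x] by (simp add: bilinear_def)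
      ultimately show "g x w z = 0" using linear_expand_axis[of "g x w" z] by simp
    qed
    then have "\<forall>w. ?A x *v w = 0 \<longrightarrow> w = 0" by (intro allI impI)
    then have "invertible (?A x)"
      by (simp only: invertible_left_inverse matrix_left_invertible_ker)
    then show ?thesis by (simp only: invertible_det_nz not_False_eq_True)
  qed
  show "?A x *v metric_grad g F x = ?b x" if x: "x \<in> U" for x
    using smooth_on_imp_differentiable[OF F x]
    by (simp add: mult x metric_metric_grad partial_eq_frechet_derivative)
qed

text \<open>The source of all derivative formulas below.  By the chain rule the covariant derivative along
  \<open>\<beta>\<close> of the gradient restricted to \<open>\<beta>\<close> is \<open>D\<^sub>\<beta>\<^sub>' grad F\<close>, whose pairing with \<open>V\<close> is the Hessian of
  \<open>F\<close> with respect to \<open>g\<close>.\<close>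

lemma has_real_derivative_grad_pairing:
  assumes F: "smooth_on U F" and \<beta>: "\<And>s. s \<in> J \<Longrightarrow> \<beta> s \<in> U" and s: "s \<in> J" and nb: "at s within J \<noteq> bot"
    and d: "\<beta> differentiable (at s within J)" "V differentiable (at s within J)"
  shows "((\<lambda>s. g (\<beta> s) (metric_grad g F (\<beta> s)) (V s)) has_real_derivative
    metric_hess g \<Gamma> F (\<beta> s) (velocity J \<beta> s) (V s)
    + g (\<beta> s) (metric_grad g F (\<beta> s)) (cov_deriv_along \<Gamma> J \<beta> V s)) (at s within J)"
proof -
  let ?G = "\<lambda>s. metric_grad g F (\<beta> s)" and ?D = "frechet_derivative (metric_grad g F) (at (\<beta> s))"
  have diff: "metric_grad g F differentiable (at (\<beta> s))"
    by (rule differentiable_metric_grad[OF F \<beta>[OF s]])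
  then have "(metric_grad g F has_derivative ?D) (at (\<beta> s))" by (simp add: frechet_derivative_works)
  from has_derivative_compose[OF has_vector_derivative_velocity[OF d(1), unfolded has_vector_derivative_def] this]
  have dG: "(?G has_vector_derivative ?D (velocity J \<beta> s)) (at s within J)"
    by (simp add: has_vector_derivative_def linear_cmul[OF linear_frechet_derivative[OF diff]])
  have "cov_deriv_along \<Gamma> J \<beta> ?G s = cov_deriv \<Gamma> (metric_grad g F) (\<beta> s) (velocity J \<beta> s)"
    by (simp add: cov_deriv_along_def cov_deriv_def velocity_eqI[OF nb dG])
  then show ?thesis
    using has_real_derivative_metric_cov[OF \<beta> s d(1) differentiableI_vector[OF dG] d(2)]
    by (simp add: metric_hess_def)
qed

lemma has_real_derivative_along_curve:
  assumes F: "smooth_on U F" and \<beta>: "\<beta> s \<in> U" and d: "\<beta> differentiable (at s within J)"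
  shows "((\<lambda>s. F (\<beta> s)) has_real_derivative g (\<beta> s) (metric_grad g F (\<beta> s)) (velocity J \<beta> s)) (at s within J)"
proof -
  have diff: "F differentiable (at (\<beta> s))" by (rule smooth_on_imp_differentiable[OF F \<beta>])
  then have "(F has_derivative frechet_derivative F (at (\<beta> s))) (at (\<beta> s))"
    by (simp add: frechet_derivative_works)
  from has_derivative_compose[OF has_vector_derivative_velocity[OF d, unfolded has_vector_derivative_def] this]
  show ?thesis
    by (simp add: has_field_derivative_def metric_metric_grad[OF \<beta> diff] mult_commute_abs
        linear_cmul[OF linear_frechet_derivative[OF diff]])
qed

end

section \<open>Rotation minimizing frames\<close>

lemma orthogonal_independent_bilinear:
  fixes b :: "'a::real_vector \<Rightarrow> 'a \<Rightarrow> real"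
  assumes b: "bilinear b" and B: "finite B" "\<And>x. x \<in> B \<Longrightarrow> b x x \<noteq> 0"
    "\<And>x y. x \<in> B \<Longrightarrow> y \<in> B \<Longrightarrow> x \<noteq> y \<Longrightarrow> b x y = 0"
  shows "independent B"
proof
  assume "dependent B"
  then obtain u x where x: "x \<in> B" "u x \<noteq> 0" and 0: "(\<Sum>v\<in>B. u v *\<^sub>R v) = 0"
    using dependent_finite[OF B(1)] by blast
  have lin: "linear (\<lambda>y. b y x)" using b by (simp add: bilinear_def)
  have "0 = b (\<Sum>v\<in>B. u v *\<^sub>R v) x" unfolding 0 using linear_0[OF lin] by simp
  also have "\<dots> = (\<Sum>v\<in>B. u v * b v x)"
    by (simp add: linear_sum[OF lin] linear_cmul[OF lin])
  also have "\<dots> = (\<Sum>v\<in>B. if v = x then u x * b x x else 0)"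
    using B(3) x(1) by (intro sum.cong) auto
  also have "\<dots> = u x * b x x" using B(1) x(1) by simp
  finally show False using x B(2)[OF x(1)] by simp
qed

text \<open>For an indefinite form the orthonormal expansion needs the signs of the basis vectors.  Subtracting
  from \<open>v\<close> its expansion in \<open>n1\<close> and \<open>n2\<close> leaves a vector orthogonal to the basis \<open>t, n1, n2\<close>, hence
  zero by nondegeneracy.\<close>

lemma pairing_via_orthonormal_normals:
  fixes b :: "real ^ 3 \<Rightarrow> real ^ 3 \<Rightarrow> real"
  assumes b: "bilinear b" and sym: "\<And>v w. b v w = b w v" and nd: "\<And>w. (\<And>z. b w z = 0) \<Longrightarrow> w = 0"
    and unit: "b t t \<in> {-1, 1}" "b n1 n1 \<in> {-1, 1}" "b n2 n2 \<in> {-1, 1}"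
    and orth: "b t n1 = 0" "b t n2 = 0" "b n1 n2 = 0" and v: "b v t = 0"
  shows "b w v = b n1 n1 * b w n1 * b v n1 + b n2 n2 * b w n2 * b v n2"
proof -
  let ?B = "{t, n1, n2}"
  have orth': "b n1 t = 0" "b n2 t = 0" "b n2 n1 = 0" using orth sym by simp_all
  have "t \<noteq> n1" "t \<noteq> n2" "n1 \<noteq> n2" using unit orth by auto
  then have card: "card ?B = 3" by simp
  have "independent ?B"
    using unit orth orth' by (intro orthogonal_independent_bilinear[OF b]) auto
  then have span: "UNIV \<subseteq> span ?B"
    by (intro card_ge_dim_independent) (simp_all add: card)
  define x where "x = v - (b n1 n1 * b v n1) *\<^sub>R n1 - (b n2 n2 * b v n2) *\<^sub>R n2"
  note bl = bilinear_lsub[OF b] bilinear_rsub[OF b] bilinear_radd[OF b] bilinear_lmul[OF b] bilinear_rmul[OF b]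
  have "b x y = 0" if "y \<in> ?B" for y
    using that unit orth orth' v by (auto simp: x_def bl)
  then have "b x z = 0" for z
    using linear_eq_0_on_span[of "b x" ?B z] b span by (auto simp: bilinear_def)
  then have "x = 0" by (rule nd)
  then have "b w (v - (b n1 n1 * b v n1) *\<^sub>R n1 - (b n2 n2 * b v n2) *\<^sub>R n2) = 0"
    using bilinear_rzero[OF b] unfolding x_def by metis
  then show ?thesis by (simp add: bl algebra_simps)
qed

lemma C2_on_reparam:
  assumes nb: "\<And>s. s \<in> J \<Longrightarrow> at s within J \<noteq> bot"
    and \<alpha>: "C2_on I \<alpha>" and \<phi>: "C2_on J \<phi>" and im: "\<phi> ` J = I"
  shows "C2_on J (\<alpha> \<circ> \<phi>)"
proof (rule C2_onI[OF nb])
  note a = C2_onD[OF \<alpha>] and p = C2_onD[OF \<phi>]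
  have chain: "((\<lambda>s. f (\<phi> s)) has_vector_derivative velocity J \<phi> s *\<^sub>R velocity I f (\<phi> s)) (at s within J)"
    if "s \<in> J" "f differentiable (at (\<phi> s) within I)" for s and f :: "real \<Rightarrow> 'a"
    using has_vector_derivative_reparam[OF im that differentiableI_vector[OF p(1)[OF that(1)]]]
    by (simp add: o_def)
  fix s assume s: "s \<in> J"
  then have I: "\<phi> s \<in> I" using im by blast
  show "((\<alpha> \<circ> \<phi>) has_vector_derivative velocity J \<phi> s *\<^sub>R velocity I \<alpha> (\<phi> s)) (at s within J)"
    using chain[OF s differentiableI_vector[OF a(1)[OF I]]] by (simp add: o_def)
  show "((\<lambda>s. velocity J \<phi> s *\<^sub>R velocity I \<alpha> (\<phi> s)) has_vector_derivative
      velocity J \<phi> s *\<^sub>R velocity J \<phi> s *\<^sub>R velocity I (velocity I \<alpha>) (\<phi> s)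
      + velocity J (velocity J \<phi>) s *\<^sub>R velocity I \<alpha> (\<phi> s)) (at s within J)"
    using p(2)[OF s] by (intro has_vector_derivative_scaleR chain[OF s differentiableI_vector[OF a(2)[OF I]]])
      (simp add: has_real_derivative_iff_has_vector_derivative)
next
  note a = C2_onD[OF \<alpha>] and p = C2_onD[OF \<phi>]
  have "continuous_on J (\<lambda>s. velocity I (velocity I \<alpha>) (\<phi> s))" "continuous_on J (\<lambda>s. velocity I \<alpha> (\<phi> s))"
    using continuous_on_compose2[OF a(5) p(3)] continuous_on_compose2[OF a(4) p(3)] im by simp_all
  then show "continuous_on J (\<lambda>s. velocity J \<phi> s *\<^sub>R velocity J \<phi> s *\<^sub>R velocity I (velocity I \<alpha>) (\<phi> s)
      + velocity J (velocity J \<phi>) s *\<^sub>R velocity I \<alpha> (\<phi> s))"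
    by (intro continuous_intros p)
qed

text \<open>The two differential identities behind the theorem.  Write \<open>f = g(grad F, t)\<close>.  Since
  \<open>g(t, t)\<close> is constant, \<open>Dt\<close> is orthogonal to \<open>t\<close>, so pairing the gradient with \<open>Dt\<close> only sees the
  normal components \<open>\<kappa>\<^sub>1, \<kappa>\<^sub>2\<close>; hence \<open>f'\<close> is the left-hand side of the linear relation.  For a normal
  \<open>n\<close> of the frame \<open>Dn\<close> is a multiple of \<open>t\<close>, so the term \<open>g(grad F, Dn)\<close> vanishes wherever \<open>f\<close>
  does.\<close>

lemma rotation_minimizing_frame_derivatives:
  assumes "metric_connection U g \<Gamma>" and F: "smooth_on U F"
    and nb: "\<And>s. s \<in> J \<Longrightarrow> at s within J \<noteq> bot" and C2: "C2_on J \<beta>" and \<beta>: "\<And>s. s \<in> J \<Longrightarrow> \<beta> s \<in> U"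
    and fr: "rotation_minimizing_frame g \<Gamma> J \<beta> t n1 n2 \<epsilon> \<epsilon>1 \<epsilon>2" and s: "s \<in> J"
  shows tangential_derivative: "((\<lambda>s. g (\<beta> s) (metric_grad g F (\<beta> s)) (t s)) has_real_derivative
      \<epsilon>2 * g (\<beta> s) (metric_grad g F (\<beta> s)) (n2 s) * normal_dev g \<Gamma> J \<beta> t n2 s
      + \<epsilon>1 * g (\<beta> s) (metric_grad g F (\<beta> s)) (n1 s) * normal_dev g \<Gamma> J \<beta> t n1 s
      + metric_hess g \<Gamma> F (\<beta> s) (t s) (t s)) (at s within J)"
    and normal_derivative: "n \<in> {n1, n2} \<Longrightarrow> g (\<beta> s) (metric_grad g F (\<beta> s)) (t s) = 0 \<Longrightarrow>
      ((\<lambda>s. g (\<beta> s) (metric_grad g F (\<beta> s)) (n s)) has_real_derivative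
        metric_hess g \<Gamma> F (\<beta> s) (t s) (n s)) (at s within J)"
proof -
  interpret metric_connection U g \<Gamma> by fact
  let ?G = "\<lambda>s. metric_grad g F (\<beta> s)" and ?Dt = "cov_deriv_along \<Gamma> J \<beta> t s"
  note bU = \<beta>[OF s]
  have ts: "t s = velocity J \<beta> s" if "s \<in> J" for s
    using fr that by (simp add: rotation_minimizing_frame_def)
  have unit: "g (\<beta> s) (t s) (t s) = \<epsilon>" if "s \<in> J" for s
    using fr that unfolding rotation_minimizing_frame_def by blast
  have d\<beta>: "\<beta> differentiable (at s within J)" using differentiableI_vector[OF C2_onD(1)[OF C2 s]] .
  have "(t has_vector_derivative velocity J (velocity J \<beta>) s) (at s within J)"
    using has_vector_derivative_transform[OF s ts C2_onD(2)[OF C2 s]] .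
  then have dt: "t differentiable (at s within J)" by (rule differentiableI_vector)
  have "((\<lambda>s. g (\<beta> s) (t s) (t s)) has_vector_derivative 0) (at s within J)"
    by (rule has_vector_derivative_transform[OF s unit]) (auto intro: has_vector_derivative_const)
  moreover have "((\<lambda>s. g (\<beta> s) (t s) (t s)) has_vector_derivative
      g (\<beta> s) ?Dt (t s) + g (\<beta> s) (t s) ?Dt) (at s within J)"
    using has_real_derivative_metric_cov[OF \<beta> s d\<beta> dt dt]
    by (simp add: has_real_derivative_iff_has_vector_derivative)
  ultimately have "g (\<beta> s) ?Dt (t s) + g (\<beta> s) (t s) ?Dt = 0"
    using vector_derivative_unique_within[OF nb[OF s]] by metis
  then have Dt: "g (\<beta> s) ?Dt (t s) = 0" using symmetric_metric[OF bU, of ?Dt "t s"] by simp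
  have "g (\<beta> s) (?G s) ?Dt = g (\<beta> s) (n1 s) (n1 s) * g (\<beta> s) (?G s) (n1 s) * g (\<beta> s) ?Dt (n1 s)
      + g (\<beta> s) (n2 s) (n2 s) * g (\<beta> s) (?G s) (n2 s) * g (\<beta> s) ?Dt (n2 s)"
    by (rule pairing_via_orthonormal_normals[OF bilinear_metric[OF bU] symmetric_metric[OF bU]
          nondegenerate_metric[OF bU], where t = "t s"])
      (use fr s Dt in \<open>auto simp: rotation_minimizing_frame_def\<close>)
  then have "g (\<beta> s) (?G s) ?Dt = \<epsilon>2 * g (\<beta> s) (?G s) (n2 s) * normal_dev g \<Gamma> J \<beta> t n2 s
      + \<epsilon>1 * g (\<beta> s) (?G s) (n1 s) * normal_dev g \<Gamma> J \<beta> t n1 s"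
    using fr s by (simp add: rotation_minimizing_frame_def normal_dev_def)
  then show "((\<lambda>s. g (\<beta> s) (?G s) (t s)) has_real_derivative
      \<epsilon>2 * g (\<beta> s) (?G s) (n2 s) * normal_dev g \<Gamma> J \<beta> t n2 s
      + \<epsilon>1 * g (\<beta> s) (?G s) (n1 s) * normal_dev g \<Gamma> J \<beta> t n1 s
      + metric_hess g \<Gamma> F (\<beta> s) (t s) (t s)) (at s within J)"
    using has_real_derivative_grad_pairing[OF F \<beta> s nb[OF s] d\<beta> dt] by (simp add: ts[OF s, symmetric] add_ac)
  assume n: "n \<in> {n1, n2}" and 0: "g (\<beta> s) (?G s) (t s) = 0"
  then obtain c where dn: "n differentiable (at s within J)" "cov_deriv_along \<Gamma> J \<beta> n s = c *\<^sub>R t s"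
    using fr s unfolding rotation_minimizing_frame_def by meson
  show "((\<lambda>s. g (\<beta> s) (?G s) (n s)) has_real_derivative metric_hess g \<Gamma> F (\<beta> s) (t s) (n s)) (at s within J)"
    using has_real_derivative_grad_pairing[OF F \<beta> s nb[OF s] d\<beta> dn(1)]
    by (simp add: ts[OF s, symmetric] dn(2) 0 bilinear_rmul[OF bilinear_metric[OF bU]])
qed

section \<open>The Hessian metric\<close>

lemma smooth_on_subset: "smooth_on S f \<Longrightarrow> T \<subseteq> S \<Longrightarrow> smooth_on T f"
  by (auto simp: smooth_on_def)

text \<open>With constant index the case distinction in the definition of \<open>h\<close> reduces to one fixed sign
  \<open>\<sigma>\<close>, so \<open>h\<close> depends on the point only through the second partial derivatives of \<open>F\<close>.\<close>

lemma metric_connection_Hessian: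
  fixes F :: "real ^ 3 \<Rightarrow> real"
  assumes U: "open U" and F: "smooth_on U F" and det: "\<And>q. q \<in> U \<Longrightarrow> det (Hess F q) \<noteq> 0"
    and ind: "\<And>q. q \<in> U \<Longrightarrow> matrix_index (Hess F q) = k" and lc: "levi_civita U (hessian_metric F) \<Gamma>"
  shows "metric_connection U (hessian_metric F) \<Gamma>"
proof -
  define \<sigma> :: real where "\<sigma> = (if k \<in> {0, 1} then 1 else -1)"
  have h: "hessian_metric F q v w = \<sigma> * inner (Hess F q *v v) w" if "q \<in> U" for q v w
    using ind[OF that] by (simp add: hessian_metric_def \<sigma>_def)
  have smooth2: "smooth_on U (partial i (partial j F))" for i j
    using F by (intro smooth_on_partial)
  let ?d = "\<lambda>q v w u. \<sigma> * (\<Sum>i\<in>UNIV. (\<Sum>j\<in>UNIV. frechet_derivative (partial i (partial j F)) (at q) u * v $ j) * w $ i)"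
  have D: "((\<lambda>x. hessian_metric F x v w) has_derivative ?d q v w) (at q)" if q: "q \<in> U" for q v w
  proof -
    have "(partial i (partial j F) has_derivative frechet_derivative (partial i (partial j F)) (at q)) (at q)" for i j
      using smooth_on_imp_differentiable[OF smooth2 q] by (simp add: frechet_derivative_works)
    then have "((\<lambda>x. \<sigma> * (\<Sum>i\<in>UNIV. (\<Sum>j\<in>UNIV. partial i (partial j F) x * v $ j) * w $ i)) has_derivative ?d q v w) (at q)"
      by (intro has_derivative_mult_right has_derivative_sum has_derivative_mult_left)
    then show ?thesis
      by (rule has_derivative_transform_within_open[OF _ U q])
        (simp add: h inner_vec_def matrix_vector_mult_def Hess_def)
  qed
  show ?thesis
  proof
    show "open U" by fact
    fix q assume q: "q \<in> U"
    have "linear (\<lambda>w. \<sigma> * inner (Hess F q *v v) w)" "linear (\<lambda>v. \<sigma> * inner (Hess F q *v v) w)" for v w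
      by (auto intro!: linearI simp: matrix_vector_right_distrib matrix_vector_mult_scaleR
          inner_add_left inner_add_right algebra_simps)
    then show "bilinear (hessian_metric F q)"
      by (simp add: bilinear_def h[OF q])
    show "(\<lambda>x. hessian_metric F x v w) differentiable (at q)" for v w
      using D[OF q] unfolding differentiable_def by blast
    show "hessian_metric F q v w = hessian_metric F q w v" for v w
      using inner_matrix_commute[OF Hess_symmetric[OF U F q], of v w] by (simp add: h[OF q] inner_commute)
    show "w = 0" if "\<And>z. hessian_metric F q w z = 0" for w
    proof -
      have "inner (Hess F q *v w) (Hess F q *v w) = 0"
        using that[of "Hess F q *v w"] by (simp add: h[OF q] \<sigma>_def split: if_splits)
      then show ?thesis using det_nonzero_imp_kernel_0[OF det[OF q]] by simp
    qed
    show "frechet_derivative (\<lambda>x. hessian_metric F x v w) (at q) u =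
        hessian_metric F q (\<Gamma> q u v) w + hessian_metric F q v (\<Gamma> q u w)" for v w u
      by (rule levi_civita_imp_metric_compatible[OF lc q])
  next
    fix v w u
    have "continuous_on U (\<lambda>q. ?d q v w u)"
      by (intro continuous_intros smooth_on_continuous_frechet_derivative smooth2)
    then show "continuous_on U (\<lambda>q. frechet_derivative (\<lambda>x. hessian_metric F x v w) (at q) u)"
      by (rule continuous_on_eq) (rule fun_cong[OF frechet_derivative_at[OF D]])
  qed
qed

text \<open>In the Riemannian case the sign in the definition of \<open>h\<close> turns a negative definite Hessian, of
  index 3, into a positive definite metric.\<close>

lemma hessian_metric_positive:
  fixes F :: "real ^ 3 \<Rightarrow> real"
  assumes "open U" "smooth_on U F" "q \<in> U" "det (Hess F q) \<noteq> 0" "matrix_index (Hess F q) \<in> {0, 3}" "v \<noteq> 0"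
  shows "hessian_metric F q v v > 0"
  using assms(5) index_0_imp_positive_definite[OF Hess_symmetric[OF assms(1-3)] assms(4) _ assms(6)]
    full_index_imp_negative_definite[OF Hess_symmetric[OF assms(1-3)] _ assms(6)]
  by (auto simp: hessian_metric_def)

section \<open>Normal development and level surfaces\<close>

lemma has_real_derivative_unique_within:
  fixes f :: "real \<Rightarrow> real"
  assumes "at s within J \<noteq> bot" "(f has_real_derivative D) (at s within J)"
    "(f has_real_derivative D') (at s within J)"
  shows "D = D'"
  using vector_derivative_unique_within[OF assms(1)] assms(2,3)
  by (simp add: has_real_derivative_iff_has_vector_derivative)

lemma has_real_derivative_locally_const:
  fixes f :: "real \<Rightarrow> real"
  assumes "s \<in> J" "\<And>x. x \<in> J \<Longrightarrow> f x = k"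
  shows "(f has_real_derivative 0) (at s within J)"
  unfolding has_real_derivative_iff_has_vector_derivative
  by (rule has_vector_derivative_transform[OF assms]) (auto intro: has_vector_derivative_const)

lemma arclength_reparam_curve:
  assumes "regular_C2_curve I \<alpha>" "arclength_reparam g I \<alpha> J \<phi> \<epsilon>"
  shows "is_interval J" "\<phi> ` J = I" "J \<noteq> {}" "\<And>s. s \<in> J \<Longrightarrow> at s within J \<noteq> bot" "C2_on J (\<alpha> \<circ> \<phi>)"
proof -
  have \<alpha>: "interior I \<noteq> {}" "C2_on I \<alpha>" using assms(1) by (auto simp: regular_C2_curve_def)
  have J: "is_interval J" "bij_betw \<phi> J I" "C2_on J \<phi>" using assms(2) by (auto simp: arclength_reparam_def)
  show "is_interval J" by fact
  show im: "\<phi> ` J = I" using J(2) by (simp add: bij_betw_def)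
  show "J \<noteq> {}" using im \<alpha>(1) by auto
  show nb: "\<And>s. s \<in> J \<Longrightarrow> at s within J \<noteq> bot"
    by (rule reparam_domain_nontrivial[OF J(2) \<alpha>(1) J(1)])
  show "C2_on J (\<alpha> \<circ> \<phi>)" by (rule C2_on_reparam[OF nb \<alpha>(2) J(3) im])
qed

text \<open>Both directions follow from the identity that the derivative of \<open>h(grad F, t) = (F \<circ> \<beta>)'\<close> is
  \<open>a\<^sub>2 \<kappa>\<^sub>2 + a\<^sub>1 \<kappa>\<^sub>1 + a\<^sub>0\<close>: on a level surface \<open>F \<circ> \<beta>\<close> is constant, so the function and its derivative
  vanish; conversely, if the derivative vanishes then the function keeps its initial value zero,
  and \<open>F \<circ> \<beta>\<close> is constant.\<close>

theorem theorem5p2p1: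
  fixes F :: "real ^ 3 \<Rightarrow> real" and \<Omega> U :: "(real ^ 3) set" and p :: "real ^ 3" and c :: real
    and \<Gamma> :: "3 christoffel"
  assumes "open \<Omega>" and "smooth_on \<Omega> F"
    and "\<forall>q \<in> level_set \<Omega> F c. egrad F q \<noteq> 0"
    and "p \<in> level_set \<Omega> F c" and "det (Hess F p) \<noteq> 0"
    and "open U" and "p \<in> U" and "U \<subseteq> \<Omega>"
    and "\<forall>q \<in> U. det (Hess F q) \<noteq> 0"
    and "\<forall>q \<in> U. matrix_index (Hess F q) = matrix_index (Hess F p)"
    and "levi_civita U (hessian_metric F) \<Gamma>"
  defines "h \<equiv> hessian_metric F"
  defines "grad \<equiv> metric_grad h F"
  defines "H \<equiv> metric_hess h \<Gamma> F"
  shows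
    "(\<forall>I \<alpha>.
       regular_C2_curve I \<alpha> \<and> \<alpha> ` I \<subseteq> U \<inter> level_set \<Omega> F c \<and>
       (matrix_index (Hess F p) \<notin> {0, 3} \<longrightarrow>
         (\<forall>u\<in>I. normal_curvature F (\<alpha> u) (velocity I \<alpha> u) \<noteq> 0)) \<longrightarrow>
       (\<exists>J \<phi> \<epsilon>. arclength_reparam h I \<alpha> J \<phi> \<epsilon>) \<and>
       (\<forall>J \<phi> \<beta> t n1 n2 \<epsilon> \<epsilon>1 \<epsilon>2 \<kappa>1 \<kappa>2 a0 a1 a2.
          arclength_reparam h I \<alpha> J \<phi> \<epsilon> \<and> \<beta> = \<alpha> \<circ> \<phi> \<and>
          rotation_minimizing_frame h \<Gamma> J \<beta> t n1 n2 \<epsilon> \<epsilon>1 \<epsilon>2 \<and>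
          \<kappa>1 = normal_dev h \<Gamma> J \<beta> t n1 \<and> \<kappa>2 = normal_dev h \<Gamma> J \<beta> t n2 \<and>
          a0 = (\<lambda>s. H (\<beta> s) (t s) (t s)) \<and>
          a1 = (\<lambda>s. \<epsilon>1 * h (\<beta> s) (grad (\<beta> s)) (n1 s)) \<and>
          a2 = (\<lambda>s. \<epsilon>2 * h (\<beta> s) (grad (\<beta> s)) (n2 s)) \<longrightarrow>
          (\<forall>s\<in>J. a2 s * \<kappa>2 s + a1 s * \<kappa>1 s + a0 s = 0) \<and>
          (\<forall>s\<in>J. (a1 has_real_derivative \<epsilon>1 * H (\<beta> s) (t s) (n1 s)) (at s within J)) \<and>
          (\<forall>s\<in>J. (a2 has_real_derivative \<epsilon>2 * H (\<beta> s) (t s) (n2 s)) (at s within J)) \<and>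
          (matrix_index (Hess F p) \<in> {0, 3} \<longrightarrow> \<epsilon>1 = 1 \<and> \<epsilon>2 = 1))) \<and>
     (\<forall>I \<alpha> J \<phi> \<beta> t n1 n2 \<epsilon> \<epsilon>1 \<epsilon>2 \<kappa>1 \<kappa>2 a0 a1 a2.
        regular_C2_curve I \<alpha> \<and> \<alpha> ` I \<subseteq> U \<and>
        (\<forall>u\<in>I. h (\<alpha> u) (velocity I \<alpha> u) (velocity I \<alpha> u) \<noteq> 0) \<and>
        arclength_reparam h I \<alpha> J \<phi> \<epsilon> \<and> \<beta> = \<alpha> \<circ> \<phi> \<and>
        rotation_minimizing_frame h \<Gamma> J \<beta> t n1 n2 \<epsilon> \<epsilon>1 \<epsilon>2 \<and>
        \<kappa>1 = normal_dev h \<Gamma> J \<beta> t n1 \<and> \<kappa>2 = normal_dev h \<Gamma> J \<beta> t n2 \<and>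
        a0 = (\<lambda>s. H (\<beta> s) (t s) (t s)) \<and>
        a1 = (\<lambda>s. \<epsilon>1 * h (\<beta> s) (grad (\<beta> s)) (n1 s)) \<and>
        a2 = (\<lambda>s. \<epsilon>2 * h (\<beta> s) (grad (\<beta> s)) (n2 s)) \<and>
        (\<forall>s\<in>J. a2 s * \<kappa>2 s + a1 s * \<kappa>1 s + a0 s = 0) \<and>
        (\<exists>s0\<in>J. h (\<beta> s0) (grad (\<beta> s0)) (t s0) = 0) \<longrightarrow>
        (\<exists>c'. \<alpha> ` I \<subseteq> level_set \<Omega> F c'))"
proof -
  have FU: "smooth_on U F" using smooth_on_subset assms(2,8) by blast
  have MC: "metric_connection U h \<Gamma>"
    unfolding h_def using assms(6,9,10,11) FU
    by (intro metric_connection_Hessian[where k = "matrix_index (Hess F p)"]) auto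
  interpret metric_connection U h \<Gamma> by fact
  have velocity_frame: "t s = velocity J \<beta> s"
    if "rotation_minimizing_frame h \<Gamma> J \<beta> t n1 n2 \<epsilon> \<epsilon>1 \<epsilon>2" "s \<in> J" for J \<beta> t n1 n2 \<epsilon> \<epsilon>1 \<epsilon>2 s
    using that unfolding rotation_minimizing_frame_def by blast
  have pos: "h q v v > 0" if "matrix_index (Hess F p) \<in> {0, 3}" "q \<in> U" "v \<noteq> 0" for q v
    unfolding h_def using that assms(6,9,10) FU by (intro hessian_metric_positive) auto
  show ?thesis
  proof (intro conjI; intro allI impI; (elim conjE)?)
    fix I \<alpha>
    assume curve: "regular_C2_curve I \<alpha>" and im: "\<alpha> ` I \<subseteq> U \<inter> level_set \<Omega> F c"
      and asym: "matrix_index (Hess F p) \<notin> {0, 3} \<longrightarrow>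
         (\<forall>u\<in>I. normal_curvature F (\<alpha> u) (velocity I \<alpha> u) \<noteq> 0)"
    have imU: "\<alpha> ` I \<subseteq> U" using im by blast
    have ne: "h (\<alpha> u) (velocity I \<alpha> u) (velocity I \<alpha> u) \<noteq> 0" if u: "u \<in> I" for u
    proof (cases "matrix_index (Hess F p) \<in> {0, 3}")
      case True
      have "velocity I \<alpha> u \<noteq> 0" using curve u by (simp add: regular_C2_curve_def)
      with pos[OF True _ this, of "\<alpha> u"] imU u show ?thesis by auto
    next
      case False
      then have "normal_curvature F (\<alpha> u) (velocity I \<alpha> u) \<noteq> 0" using asym u by blast
      then show ?thesis by (auto simp: h_def hessian_metric_def normal_curvature_def)
    qed
    show "(\<exists>J \<phi> \<epsilon>. arclength_reparam h I \<alpha> J \<phi> \<epsilon>) \<and>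
       (\<forall>J \<phi> \<beta> t n1 n2 \<epsilon> \<epsilon>1 \<epsilon>2 \<kappa>1 \<kappa>2 a0 a1 a2.
          arclength_reparam h I \<alpha> J \<phi> \<epsilon> \<and> \<beta> = \<alpha> \<circ> \<phi> \<and>
          rotation_minimizing_frame h \<Gamma> J \<beta> t n1 n2 \<epsilon> \<epsilon>1 \<epsilon>2 \<and>
          \<kappa>1 = normal_dev h \<Gamma> J \<beta> t n1 \<and> \<kappa>2 = normal_dev h \<Gamma> J \<beta> t n2 \<and>
          a0 = (\<lambda>s. H (\<beta> s) (t s) (t s)) \<and>
          a1 = (\<lambda>s. \<epsilon>1 * h (\<beta> s) (grad (\<beta> s)) (n1 s)) \<and>
          a2 = (\<lambda>s. \<epsilon>2 * h (\<beta> s) (grad (\<beta> s)) (n2 s)) \<longrightarrow>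
          (\<forall>s\<in>J. a2 s * \<kappa>2 s + a1 s * \<kappa>1 s + a0 s = 0) \<and>
          (\<forall>s\<in>J. (a1 has_real_derivative \<epsilon>1 * H (\<beta> s) (t s) (n1 s)) (at s within J)) \<and>
          (\<forall>s\<in>J. (a2 has_real_derivative \<epsilon>2 * H (\<beta> s) (t s) (n2 s)) (at s within J)) \<and>
          (matrix_index (Hess F p) \<in> {0, 3} \<longrightarrow> \<epsilon>1 = 1 \<and> \<epsilon>2 = 1))"
    proof (rule conjI[OF arclength_reparam_exists[OF curve imU ne]]; (intro allI impI)?; (elim conjE)?)
      fix J \<phi> \<beta> t n1 n2 \<epsilon> \<epsilon>1 \<epsilon>2 \<kappa>1 \<kappa>2 a0 a1 a2
      assume rep: "arclength_reparam h I \<alpha> J \<phi> \<epsilon>" and \<beta>: "\<beta> = \<alpha> \<circ> \<phi>"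
        and fr: "rotation_minimizing_frame h \<Gamma> J \<beta> t n1 n2 \<epsilon> \<epsilon>1 \<epsilon>2"
        and \<kappa>: "\<kappa>1 = normal_dev h \<Gamma> J \<beta> t n1" "\<kappa>2 = normal_dev h \<Gamma> J \<beta> t n2"
        and a: "a0 = (\<lambda>s. H (\<beta> s) (t s) (t s))" "a1 = (\<lambda>s. \<epsilon>1 * h (\<beta> s) (grad (\<beta> s)) (n1 s))"
          "a2 = (\<lambda>s. \<epsilon>2 * h (\<beta> s) (grad (\<beta> s)) (n2 s))"
      note J = arclength_reparam_curve[OF curve rep, folded \<beta>]
      have inI: "\<phi> s \<in> I" if "s \<in> J" for s using J(2) that by blast
      have \<beta>U: "\<beta> s \<in> U" and F\<beta>: "F (\<beta> s) = c" if "s \<in> J" for s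
        using im inI[OF that] by (auto simp: \<beta> level_set_def)
      \<comment> \<open>The gradient is orthogonal to the curve, since \<open>F \<circ> \<beta>\<close> is constantly \<open>c\<close>.\<close>
      have tangent: "h (\<beta> s) (metric_grad h F (\<beta> s)) (t s) = 0" if s: "s \<in> J" for s
        unfolding velocity_frame[OF fr s]
        by (rule has_real_derivative_unique_within[OF J(4)[OF s]
              has_real_derivative_along_curve[OF FU \<beta>U[OF s] differentiableI_vector[OF C2_onD(1)[OF J(5) s]]]
              has_real_derivative_locally_const[OF s F\<beta>]])
      have "a2 s * \<kappa>2 s + a1 s * \<kappa>1 s + a0 s = 0" if s: "s \<in> J" for s
        using has_real_derivative_unique_within[OF J(4)[OF s] tangential_derivative[OF MC FU J(4,5) \<beta>U fr s]
            has_real_derivative_locally_const[OF s tangent]]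
        by (simp add: a \<kappa> H_def grad_def)
      moreover have "(a1 has_real_derivative \<epsilon>1 * H (\<beta> s) (t s) (n1 s)) (at s within J)" if s: "s \<in> J" for s
        unfolding a H_def grad_def 
        by (rule DERIV_cmult[OF normal_derivative[OF MC FU J(4,5) \<beta>U fr s insertI1 tangent[OF s]]])
      moreover have "(a2 has_real_derivative \<epsilon>2 * H (\<beta> s) (t s) (n2 s)) (at s within J)" if s: "s \<in> J" for s
        unfolding a H_def grad_def 
        by (rule DERIV_cmult[OF normal_derivative[OF MC FU J(4,5) \<beta>U fr s insertI2[OF insertI1] tangent[OF s]]])
      moreover have "\<epsilon>1 = 1 \<and> \<epsilon>2 = 1" if ind: "matrix_index (Hess F p) \<in> {0, 3}"
      proof -
        obtain s where s: "s \<in> J" using J(3) by blast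
        have u: "h (\<beta> s) (n1 s) (n1 s) = \<epsilon>1" "h (\<beta> s) (n2 s) (n2 s) = \<epsilon>2" "\<epsilon>1 \<in> {-1, 1}" "\<epsilon>2 \<in> {-1, 1}"
          using fr s unfolding rotation_minimizing_frame_def by blast+
        \<comment> \<open>The normals are nonzero, so positive definiteness excludes the value \<open>-1\<close>.\<close>
        have "h (\<beta> s) 0 0 = 0" by (rule bilinear_lzero[OF bilinear_metric[OF \<beta>U[OF s]]])
        then have "n1 s \<noteq> 0" "n2 s \<noteq> 0" using u by auto
        then show ?thesis using pos[OF ind \<beta>U[OF s]] u by force
      qed
      ultimately show "(\<forall>s\<in>J. a2 s * \<kappa>2 s + a1 s * \<kappa>1 s + a0 s = 0) \<and>
          (\<forall>s\<in>J. (a1 has_real_derivative \<epsilon>1 * H (\<beta> s) (t s) (n1 s)) (at s within J)) \<and>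
          (\<forall>s\<in>J. (a2 has_real_derivative \<epsilon>2 * H (\<beta> s) (t s) (n2 s)) (at s within J)) \<and>
          (matrix_index (Hess F p) \<in> {0, 3} \<longrightarrow> \<epsilon>1 = 1 \<and> \<epsilon>2 = 1)" by blast
    qed
  next
    fix I \<alpha> J \<phi> \<beta> t n1 n2 \<epsilon> \<epsilon>1 \<epsilon>2 \<kappa>1 \<kappa>2 a0 a1 a2
    assume curve: "regular_C2_curve I \<alpha>" and im: "\<alpha> ` I \<subseteq> U"
      and rep: "arclength_reparam h I \<alpha> J \<phi> \<epsilon>" and \<beta>: "\<beta> = \<alpha> \<circ> \<phi>"
      and fr: "rotation_minimizing_frame h \<Gamma> J \<beta> t n1 n2 \<epsilon> \<epsilon>1 \<epsilon>2"
      and \<kappa>: "\<kappa>1 = normal_dev h \<Gamma> J \<beta> t n1" "\<kappa>2 = normal_dev h \<Gamma> J \<beta> t n2"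
      and a: "a0 = (\<lambda>s. H (\<beta> s) (t s) (t s))" "a1 = (\<lambda>s. \<epsilon>1 * h (\<beta> s) (grad (\<beta> s)) (n1 s))"
        "a2 = (\<lambda>s. \<epsilon>2 * h (\<beta> s) (grad (\<beta> s)) (n2 s))"
      and eq: "\<forall>s\<in>J. a2 s * \<kappa>2 s + a1 s * \<kappa>1 s + a0 s = 0"
      and start: "\<exists>s0\<in>J. h (\<beta> s0) (grad (\<beta> s0)) (t s0) = 0"
    note J = arclength_reparam_curve[OF curve rep, folded \<beta>]
    have \<beta>U: "\<beta> s \<in> U" if "s \<in> J" for s using im J(2) that by (auto simp: \<beta>)
    have convex: "convex J" using J(1) by (rule is_interval_convex)
    have "((\<lambda>s. h (\<beta> s) (metric_grad h F (\<beta> s)) (t s)) has_real_derivative 0) (at s within J)" if s: "s \<in> J" for s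
      using tangential_derivative[OF MC FU J(4,5) \<beta>U fr s] bspec[OF eq s]
      by (simp add: a \<kappa> H_def grad_def)
    then obtain k where k: "\<forall>s\<in>J. h (\<beta> s) (metric_grad h F (\<beta> s)) (t s) = k"
      using has_field_derivative_zero_constant[OF convex] by blast
    then have "k = 0" using start by (auto simp: grad_def)
    then have tangent: "h (\<beta> s) (metric_grad h F (\<beta> s)) (velocity J \<beta> s) = 0" if s: "s \<in> J" for s
      using k s velocity_frame[OF fr s] by auto
    have "((\<lambda>s. F (\<beta> s)) has_real_derivative 0) (at s within J)" if s: "s \<in> J" for s
      using has_real_derivative_along_curve[OF FU \<beta>U[OF s] differentiableI_vector[OF C2_onD(1)[OF J(5) s]]]
      by (simp add: tangent[OF s])
    then obtain c' where "\<forall>s\<in>J. F (\<beta> s) = c'"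
      using has_field_derivative_zero_constant[OF convex] by blast
    then have "\<alpha> ` I \<subseteq> level_set \<Omega> F c'"
      using im assms(8) J(2) by (auto simp: \<beta> level_set_def)
    then show "\<exists>c'. \<alpha> ` I \<subseteq> level_set \<Omega> F c'" by blast
  qed
qed

end
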